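(* For any $0<\varepsilon<1$, any $n\geq20$, and any bounded convex set $\mathcal{K}\subset\mathbb{R}^n$ with nonempty interior, there is a discrete set $L\subset\mathbb{R}^n$ which has an asymptotic density and satisfies $$\mathrm{vol}(\mathcal{K})\,D(L)\leq\frac{14}{\varepsilon^2}\left(n\log n+n\log\frac{1280}{\varepsilon}+2\right)\quad\text{and}\quad\eta(\mathcal{K},L)<\varepsilon.$$
   Context: For a discrete set $L\subset\mathbb{R}^n$, let $B(0,T)$ be the Euclidean ball of radius $T$ centered at $0$ and $D(L)=\limsup_{T\to\infty}\frac{|B(0,T)\cap L|}{\mathrm{vol}(B(0,T))}$; $L$ has an asymptotic density if this limit exists. With $N(L,\mathcal{K},x)=|L\cap(\mathcal{K}+x)|$, define $\eta(\mathcal{K},L)=\sup_{x\in\mathbb{R}^n}\left|\frac{N(L,\mathcal{K},x)}{\mathrm{vol}(\mathcal{K})D(L)}-1\right|$. Logarithms are natural. *)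

theory Defs
  imports "HOL-Analysis.Analysis"
begin

(* card maps infinite sets to 0, so |A| is taken in the extended reals, with |A| = \<infinity> for infinite A. *)
definition ecount :: "'a set \<Rightarrow> ereal" where
  "ecount A = (if finite A then ereal (real (card A)) else \<infinity>)"

(* Convex sets are Lebesgue measurable but not necessarily Borel, hence lebesgue and not lborel. *)
abbreviation vol :: "'a::euclidean_space set \<Rightarrow> real" where
  "vol \<equiv> measure lebesgue"

definition ball_density :: "'a::euclidean_space set \<Rightarrow> real \<Rightarrow> ereal" where
  "ball_density L T = ecount (cball 0 T \<inter> L) / ereal (vol (cball (0::'a) T))"

definition upper_density :: "'a::euclidean_space set \<Rightarrow> ereal" where
  "upper_density L = Limsup at_top (ball_density L)"

definition has_asymptotic_density :: "'a::euclidean_space set \<Rightarrow> bool" where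
  "has_asymptotic_density L \<longleftrightarrow> (\<exists>d::real. (ball_density L \<longlongrightarrow> ereal d) at_top)"

definition translate_count :: "'a::euclidean_space set \<Rightarrow> 'a set \<Rightarrow> 'a \<Rightarrow> ereal" where
  "translate_count L K x = ecount (L \<inter> (\<lambda>y. y + x) ` K)"

(* If upper_density L is 0 or \<infinity> and vol K > 0, the conventions for division in ereal make
   this at least 1, so a bound eta K L < \<epsilon> with \<epsilon> < 1 excludes these degenerate cases. *)
definition eta :: "'a::euclidean_space set \<Rightarrow> 'a set \<Rightarrow> ereal" where
  "eta K L = (SUP x. \<bar>translate_count L K x / (ereal (vol K) * upper_density L) - 1\<bar>)"

end

(*
Up to an affine map, K lies in the cube [-2/5, 2/5]^n and contains a cube of radius 1/(6n): take
the largest simplex with one vertex at a fixed interior point and its other vertices in the closure of K.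
Then (1 + d) K embeds into the torus R^n/Z^n for small d, and L is the preimage of N points of that torus.

Chosen at random, the points satisfy a Chernoff bound for a single translate. A union bound over the translates
of (1 + d) K and (1 - d) K by a grid of about (n^2/epsilon)^n vectors, with d = epsilon/(20 n), suffices:
every translate K + x lies between (1 - d) K + y and (1 + d) K + y for some grid vector y, and these have
volume within a factor 1 +- epsilon/10 of vol K.
*)
theory Submission
  imports Defs "HOL-Probability.Probability_Measure"
begin


text \<open>The half-width 2/5 leaves room for the enlargement: coordinates of points of (1 + d) K
  differ by at most (4/5)(21/20) < 1. Hence translates of (1 + d) K project injectively to the
  torus, the probability of hitting one is its volume, and a count in R^n is a count on the torus.
  The inner cube governs the cost of the union bound. The grid needs mesh at most d/(6n), which is
  where (n^2/\<epsilon>)^n comes from; the logarithm of this number is at most 2n log(1280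
  n/\<epsilon>). Tolerance: a count may deviate from its target by 9\<epsilon>/10 in relative terms,
  of which \<epsilon>/10 is lost to the change of volume. The remaining 4\<epsilon>/5 gives a
  Chernoff exponent (4/25) \<epsilon>^2 per unit of expected count, and 14 * 4/25 > 2 beats the
  grid. That 9\<epsilon>/10 is less than \<epsilon> makes the final inequality strict even for a
  supremum.\<close>

section \<open>Choosing distinct points by conditional expectations\<close>

lemma (in prob_space) exists_le_expectation:
  fixes f :: "'a \<Rightarrow> real"
  assumes "integrable M f" "F \<in> null_sets M"
  shows "\<exists>p\<in>space M - F. f p \<le> expectation f"
proof (rule ccontr)
  assume "\<not> ?thesis"
  then have *: "\<And>p. p \<in> space M \<Longrightarrow> p \<notin> F \<Longrightarrow> expectation f < f p"
    by force
  have "AE p in M. expectation f < f p"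
    using AE_not_in[OF assms(2)] AE_space by eventually_elim (use * in auto)
  then have "expectation f < expectation f"
    by (intro expectation_greater assms)
  then show False by simp
qed

text \<open>In its use \<open>F\<close> is the set of points already chosen: a set counts without
  multiplicity, so repetitions must be avoided, and leaving out a null set does not affect the
  mean.\<close>

lemma (in prob_space) exists_low_potential_step:
  fixes w c :: "'j \<Rightarrow> real"
  assumes "\<And>j. j \<in> J \<Longrightarrow> A j \<in> sets M" "F \<in> null_sets M"
  shows "\<exists>p\<in>space M - F. (\<Sum>j\<in>J. w j * (if p \<in> A j then c j else 1))
           \<le> (\<Sum>j\<in>J. w j * (1 + (c j - 1) * prob (A j)))"
proof -
  let ?f = "\<lambda>p. \<Sum>j\<in>J. w j * (1 + (c j - 1) * indicat_real (A j) p)"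
  have k: "integrable M (indicat_real (A j))" if "j \<in> J" for j
    using assms(1)[OF that] by (intro integrable_real_indicator) (auto simp: emeasure_eq_measure)
  have i: "integrable M (\<lambda>p. w j * (1 + (c j - 1) * indicat_real (A j) p))" if "j \<in> J" for j
    using k[OF that] by (intro integrable_mult_right Bochner_Integration.integrable_add integrable_const)
  have e: "expectation (\<lambda>p. w j * (1 + (c j - 1) * indicat_real (A j) p))
      = w j * (1 + (c j - 1) * prob (A j))" if "j \<in> J" for j
    using assms(1)[OF that] k[OF that] by (simp add: prob_space)
  have E: "expectation ?f = (\<Sum>j\<in>J. w j * (1 + (c j - 1) * prob (A j)))"
    by (subst Bochner_Integration.integral_sum) (use i e in \<open>auto intro!: sum.cong simp del: Bochner_Integration.integral_mult_right_zero\<close>)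
  have "integrable M ?f" by (intro Bochner_Integration.integrable_sum i)
  from exists_le_expectation[OF this assms(2)] obtain p where
    p: "p \<in> space M - F" "?f p \<le> expectation ?f" by blast
  have "?f p = (\<Sum>j\<in>J. w j * (if p \<in> A j then c j else 1))"
    by (intro sum.cong) auto
  with p E show ?thesis by auto
qed

text \<open>Derandomised Chernoff bound: the right-hand side is the mean of the left-hand side over N
  independent samples, and the points are picked one at a time without raising the conditional mean.\<close>

lemma (in prob_space) exists_low_potential:
  fixes w c :: "'j \<Rightarrow> real"
  assumes A: "\<And>j. j \<in> J \<Longrightarrow> A j \<in> sets M"
    and null: "\<And>p. p \<in> space M \<Longrightarrow> {p} \<in> null_sets M"
  shows "\<exists>P\<subseteq>space M. finite P \<and> card P = N \<and>
     (\<Sum>j\<in>J. w j * c j ^ card (P \<inter> A j)) \<le> (\<Sum>j\<in>J. w j * (1 + (c j - 1) * prob (A j)) ^ N)"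
proof (induction N arbitrary: w)
  case 0
  then show ?case by (intro exI[of _ "{}"]) auto
next
  case (Suc N)
  let ?e = "\<lambda>j. 1 + (c j - 1) * prob (A j)"
  \<comment> \<open>The expected factor \<open>?e j\<close> of the point still to come is absorbed
    into the weights; hence the induction runs over all \<open>w\<close>.\<close>
  obtain P where P: "P \<subseteq> space M" "finite P" "card P = N"
    and le: "(\<Sum>j\<in>J. w j * ?e j * c j ^ card (P \<inter> A j)) \<le> (\<Sum>j\<in>J. w j * ?e j * ?e j ^ N)"
    using Suc[of "\<lambda>j. w j * ?e j"] by auto
  have "(\<Union>p\<in>P. {p}) \<in> null_sets M"
    using P null by (intro null_sets_UN' countable_finite) auto
  then have "P \<in> null_sets M" by simp
  from exists_low_potential_step[of J A, OF A this, where c = c and w = "\<lambda>j. w j * c j ^ card (P \<inter> A j)"]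
  obtain p where p: "p \<in> space M" "p \<notin> P" and
   le2: "(\<Sum>j\<in>J. w j * c j ^ card (P \<inter> A j) * (if p \<in> A j then c j else 1))
      \<le> (\<Sum>j\<in>J. w j * c j ^ card (P \<inter> A j) * ?e j)" by auto
  have "c j ^ card (insert p P \<inter> A j) = c j ^ card (P \<inter> A j) * (if p \<in> A j then c j else 1)" for j
    using p P(2) by (simp add: Int_insert_left)
  then have "(\<Sum>j\<in>J. w j * c j ^ card (insert p P \<inter> A j)) \<le> (\<Sum>j\<in>J. w j * c j ^ card (P \<inter> A j) * ?e j)"
    using le2 by (simp add: mult.assoc)
  also have "\<dots> \<le> (\<Sum>j\<in>J. w j * ?e j ^ Suc N)"
    using le by (simp add: mult_ac)
  finally show ?case using p P by (intro exI[of _ "insert p P"]) auto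
qed

section \<open>The torus R^n/Z^n and its volume\<close>

text \<open>The torus is modelled by the half-open cell \<open>unit_cell\<close> with
  \<open>vfrac\<close> as projection. Lattice vectors occur only as values of \<open>vfloor\<close>,
  so that everything stays in \<open>real ^ 'n\<close>.\<close>

definition vfloor :: "real ^ 'n \<Rightarrow> real ^ 'n" where
  "vfloor v = (\<chi> i. of_int \<lfloor>v $ i\<rfloor>)"

definition vfrac :: "real ^ 'n \<Rightarrow> real ^ 'n" where
  "vfrac v = (\<chi> i. frac (v $ i))"

definition unit_cell :: "(real ^ 'n) set" where
  "unit_cell = {v. \<forall>i. 0 \<le> v $ i \<and> v $ i < 1}"

lemma vfrac_eq: "vfrac v = v - vfloor v"
  by (simp add: vfrac_def vfloor_def vec_eq_iff frac_def)

lemma vfrac_in_unit_cell: "vfrac v \<in> unit_cell"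
  by (simp add: vfrac_def unit_cell_def frac_lt_1)

lemma vfrac_add_vfloor: "vfrac (u + vfloor v) = vfrac u"
  by (simp add: vec_eq_iff vfrac_def vfloor_def frac_def)

lemma vfrac_unit_cell: "v \<in> unit_cell \<Longrightarrow> vfrac v = v"
  by (simp add: vec_eq_iff vfrac_def unit_cell_def frac_eq)

text \<open>Shifts that agree modulo Z^n act alike on the torus, so the grid has to approximate only
  vectors of the unit cell.\<close>

lemma vfrac_image_translate: "vfrac ` ((+) x ` S) = vfrac ` ((+) (vfrac x) ` S)"
proof -
  have "vfrac (x + u) = vfrac (vfrac x + u)" for u
    using vfrac_add_vfloor[of "vfrac x + u" x] by (simp add: vfrac_eq algebra_simps)
  then show ?thesis by (simp add: image_image)
qed

text \<open>Equal fractional parts make every coordinate of the difference an integer, and 0 is the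
  only integer of absolute value below 1.\<close>

lemma inj_on_vfrac:
  fixes S :: "(real ^ 'n) set"
  assumes "\<And>u v i. u \<in> S \<Longrightarrow> v \<in> S \<Longrightarrow> \<bar>u $ i - v $ i\<bar> < 1"
  shows "inj_on vfrac S"
proof (rule inj_onI)
  fix u v assume uv: "u \<in> S" "v \<in> S" and eq: "vfrac u = vfrac v"
  show "u = v"
  proof (rule vec_eq_iff[THEN iffD2], rule allI)
    fix i
    have f: "frac (u $ i) = frac (v $ i)" using eq by (simp add: vec_eq_iff vfrac_def)
    then have "u $ i - v $ i = of_int (\<lfloor>u $ i\<rfloor> - \<lfloor>v $ i\<rfloor>)" by (simp add: frac_def algebra_simps)
    moreover have "\<bar>u $ i - v $ i\<bar> < 1" using assms uv by blast
    ultimately have "\<lfloor>u $ i\<rfloor> - \<lfloor>v $ i\<rfloor> = 0" by linarith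
    with f show "u $ i = v $ i" by (simp add: frac_def)
  qed
qed

lemma unit_cell_between: "box 0 1 \<subseteq> unit_cell" "unit_cell \<subseteq> cbox 0 (1 :: real ^ 'n)"
  by (auto simp: unit_cell_def mem_box_cart less_imp_le)

lemma lmeasurable_unit_cell: "(unit_cell :: (real ^ 'n) set) \<in> lmeasurable"
proof (rule measurable_convex)
  show "convex (unit_cell :: (real ^ 'n) set)"
    by (auto simp: convex_alt unit_cell_def intro!: convex_bound_lt add_nonneg_nonneg)
  show "bounded (unit_cell :: (real ^ 'n) set)"
    using bounded_cbox unit_cell_between(2) by (rule bounded_subset)
qed

text \<open>The half-open cell lies between an open and a closed cube that differ by a negligible
  frontier.\<close>

lemma measure_unit_cell: "measure lebesgue (unit_cell :: (real ^ 'n) set) = 1"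
proof -
  have ne: "box 0 (1 :: real ^ 'n) \<noteq> {}"
    by (simp add: interval_ne_empty_cart)
  have c: "measure lebesgue (cbox 0 (1 :: real ^ 'n)) = 1"
    using content_cbox_cart[of "0 :: real ^ 'n" 1] by (simp add: interval_eq_empty_cart)
  have "measure lebesgue (closure (box 0 (1 :: real ^ 'n))) = measure lebesgue (box 0 (1 :: real ^ 'n))"
    by (intro measure_closure bounded_box negligible_convex_frontier convex_box)
  then have b: "measure lebesgue (box 0 (1 :: real ^ 'n)) = 1"
    using c unfolding closure_box[OF ne] by metis
  have "measure lebesgue (box 0 (1 :: real ^ 'n)) \<le> measure lebesgue (unit_cell :: (real ^ 'n) set)"
    by (intro measure_mono_fmeasurable unit_cell_between lmeasurable_unit_cell) auto
  moreover have "measure lebesgue (unit_cell :: (real ^ 'n) set) \<le> measure lebesgue (cbox 0 (1 :: real ^ 'n))"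
    by (intro measure_mono_fmeasurable unit_cell_between fmeasurableD lmeasurable_unit_cell) auto
  ultimately show ?thesis using b c by simp
qed

lemma finite_vfloor_image:
  fixes S :: "(real ^ 'n) set"
  assumes "bounded S"
  shows "finite (vfloor ` S)"
proof -
  obtain B where B: "\<And>v. v \<in> S \<Longrightarrow> norm v \<le> B" using assms by (auto simp: bounded_iff)
  let ?I = "{-\<lceil>B\<rceil>-1..\<lceil>B\<rceil>+1}"
  have "vfloor ` S \<subseteq> (\<lambda>k. \<chi> i. of_int (k i)) ` (UNIV \<rightarrow>\<^sub>E ?I)"
  proof
    fix z assume "z \<in> vfloor ` S"
    then obtain v where v: "v \<in> S" "z = vfloor v" by auto
    have "\<lfloor>v $ i\<rfloor> \<in> ?I" for i
      using component_le_norm_cart[of v i] B[OF v(1)] by (simp; linarith)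
    then show "z \<in> (\<lambda>k. \<chi> i. of_int (k i)) ` (UNIV \<rightarrow>\<^sub>E ?I)"
      using v by (intro image_eqI[of _ _ "\<lambda>i. \<lfloor>v $ i\<rfloor>"]) (auto simp: vfloor_def)
  qed
  moreover have "finite ((UNIV :: 'n set) \<rightarrow>\<^sub>E ?I)" by (intro finite_PiE) auto
  ultimately show ?thesis by (meson finite_imageI finite_subset)
qed

lemma vfloor_eq_iff: "vfloor v = vfloor w \<longleftrightarrow> v - vfloor w \<in> unit_cell"
proof
  assume "v - vfloor w \<in> unit_cell"
  then have "of_int \<lfloor>w $ i\<rfloor> \<le> v $ i \<and> v $ i < of_int \<lfloor>w $ i\<rfloor> + 1" for i
    by (simp add: unit_cell_def vfloor_def) (smt (verit))
  then have "\<lfloor>v $ i\<rfloor> = \<lfloor>w $ i\<rfloor>" for i by (intro floor_unique) auto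
  then show "vfloor v = vfloor w" by (simp add: vfloor_def vec_eq_iff)
qed (metis vfrac_eq vfrac_in_unit_cell)

text \<open>The lattice cells cut \<open>S\<close> into finitely many pieces, and
  \<open>vfrac\<close> translates each of them into the unit cell. Injectivity keeps the translated
  pieces disjoint, so the volumes add up.\<close>

lemma
  fixes S :: "(real ^ 'n) set"
  assumes S: "S \<in> lmeasurable" "bounded S" and inj: "inj_on vfrac S"
  shows lmeasurable_vfrac_image: "vfrac ` S \<in> lmeasurable"
    and measure_vfrac_image: "measure lebesgue (vfrac ` S) = measure lebesgue S"
proof -
  define c where "c = (\<lambda>z. S \<inter> (+) z ` unit_cell)"
  have c_alt: "c (vfloor w) = {v \<in> S. vfloor v = vfloor w}" for w
    by (force simp: c_def vfloor_eq_iff image_iff algebra_simps)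
  let ?Z = "vfloor ` S"
  have fin: "finite ?Z" by (rule finite_vfloor_image) fact
  have cm: "c z \<in> lmeasurable" for z
    unfolding c_def by (intro fmeasurable_Int_fmeasurable S(1) fmeasurableD measurable_translation lmeasurable_unit_cell)
  have tm: "(\<lambda>v. v - z) ` c z \<in> lmeasurable" for z
    by (intro measurable_translation_subtract cm)
  have S_eq: "S = (\<Union>z\<in>?Z. c z)" by (auto simp: c_alt)
  have f_eq: "vfrac ` S = (\<Union>z\<in>?Z. (\<lambda>v. v - z) ` c z)"
    by (force simp: c_alt vfrac_eq)
  have djS: "disjoint_family_on c ?Z" by (auto simp: disjoint_family_on_def c_alt)
  have djf: "disjoint_family_on (\<lambda>z. (\<lambda>v. v - z) ` c z) ?Z"
  proof (unfold disjoint_family_on_def, intro ballI impI)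
    fix a b assume ab: "a \<in> ?Z" "b \<in> ?Z" "a \<noteq> b"
    show "(\<lambda>v. v - a) ` c a \<inter> (\<lambda>v. v - b) ` c b = {}"
    proof (rule ccontr)
      assume "\<not> ?thesis"
      then obtain u v where uv: "u \<in> c a" "v \<in> c b" "u - a = v - b" by auto
      have "u \<in> S" "v \<in> S" "vfloor u = a" "vfloor v = b"
        using uv ab by (auto simp: c_alt)
      then have "vfrac u = vfrac v" using uv by (simp add: vfrac_eq)
      with \<open>u \<in> S\<close> \<open>v \<in> S\<close> inj have "u = v" by (auto dest: inj_onD)
      with \<open>vfloor u = a\<close> \<open>vfloor v = b\<close> ab show False by simp
    qed
  qed
  show "vfrac ` S \<in> lmeasurable" unfolding f_eq by (intro fmeasurable.finite_UN fin tm)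
  have "measure lebesgue (vfrac ` S) = (\<Sum>z\<in>?Z. measure lebesgue ((\<lambda>v. v - z) ` c z))"
    unfolding f_eq using fmeasurableD[OF tm] fmeasurableD2[OF tm]
    by (intro measure_finite_Union[OF fin _ djf]) auto
  also have "\<dots> = (\<Sum>z\<in>?Z. measure lebesgue (c z))" by (simp add: measure_translation_subtract)
  also have "\<dots> = measure lebesgue (\<Union>z\<in>?Z. c z)"
    using fmeasurableD[OF cm] fmeasurableD2[OF cm]
    by (intro measure_finite_Union[OF fin _ djS, symmetric]) auto
  finally show "measure lebesgue (vfrac ` S) = measure lebesgue S" using S_eq by simp
qed


section \<open>Chernoff estimates and the arithmetic of the union bound\<close>

text \<open>The gain in the upper tail is of order \<epsilon>^2, so the logarithm is needed to
  second order.\<close>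

lemma ln_one_plus_ge:
  fixes s :: real
  assumes "0 \<le> s"
  shows "s - s\<^sup>2 / 2 \<le> ln (1 + s)"
proof -
  let ?f = "\<lambda>s::real. ln (1 + s) - s + s\<^sup>2 / 2"
  have "?f 0 \<le> ?f s"
  proof (rule DERIV_nonneg_imp_nondecreasing[OF assms], intro exI conjI)
    fix x :: real assume "0 \<le> x" "x \<le> s"
    show "(?f has_real_derivative 1 / (1 + x) - 1 + x) (at x)"
      using \<open>0 \<le> x\<close> by (auto intro!: derivative_eq_intros)
    have "1 / (1 + x) - 1 + x = x\<^sup>2 / (1 + x)"
      using \<open>0 \<le> x\<close> by (simp add: field_simps power2_eq_square)
    then show "0 \<le> 1 / (1 + x) - 1 + x" using \<open>0 \<le> x\<close> by simp
  qed
  then show ?thesis by simp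
qed

text \<open>With N q the expected count, these are the moment generating functions of a binomial count,
  normalised at the thresholds (1 + 9\<epsilon>/10) N q and (1 - 9\<epsilon>/10) N q; the slack \<epsilon>/10 in p pays for
  the discretisation of the translations.\<close>

lemma chernoff_upper:
  fixes \<epsilon> p q :: real and N :: nat
  assumes "0 < \<epsilon>" "\<epsilon> < 1" "0 \<le> p" "0 \<le> q" "p \<le> (1 + \<epsilon> / 10) * q"
  shows "(1 + 2 * \<epsilon> / 5) powr (-(1 + 9 / 10 * \<epsilon>) * (N * q)) * (1 + 2 * \<epsilon> / 5 * p) ^ N
    \<le> exp (- (4 / 25) * \<epsilon>\<^sup>2 * (N * q))"
proof -
  define s \<mu> where "s = 2 * \<epsilon> / 5" and "\<mu> = N * q"
  have s: "0 < s" and \<mu>: "0 \<le> \<mu>" using assms by (auto simp: s_def \<mu>_def)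
  have "(1 + s * p) ^ N \<le> exp (s * p) ^ N"
    using s assms by (intro power_mono) (auto intro: add_nonneg_nonneg)
  also have "\<dots> = exp (N * (s * p))" by (simp add: exp_of_nat_mult)
  also have "\<dots> \<le> exp (s * (1 + \<epsilon> / 10) * \<mu>)"
  proof -
    have "N * s * p \<le> N * s * ((1 + \<epsilon> / 10) * q)"
      using s assms by (intro mult_left_mono) auto
    then show ?thesis by (simp add: \<mu>_def mult_ac)
  qed
  finally have 1: "(1 + s * p) ^ N \<le> exp (s * (1 + \<epsilon> / 10) * \<mu>)" .
  \<comment> \<open>The exponent is then at most (-6/25 + 9/125) \<epsilon>^2 = -(21/125)
    \<epsilon>^2, just enough for -(4/25) \<epsilon>^2 = -(20/125) \<epsilon>^2.\<close>
  have "\<epsilon> ^ 3 \<le> \<epsilon> ^ 2" using assms by (intro power_decreasing) auto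
  moreover have "s * (1 + \<epsilon> / 10) - (1 + 9 / 10 * \<epsilon>) * (s - s\<^sup>2 / 2) = - (6 / 25) * \<epsilon>\<^sup>2 + 9 / 125 * \<epsilon> ^ 3"
    by (simp add: s_def field_simps power2_eq_square power3_eq_cube)
  ultimately have 2: "s * (1 + \<epsilon> / 10) - (1 + 9 / 10 * \<epsilon>) * (s - s\<^sup>2 / 2) \<le> - (4 / 25) * \<epsilon>\<^sup>2"
    using zero_le_power2[of \<epsilon>] by linarith
  have "(1 + 9 / 10 * \<epsilon>) * (s - s\<^sup>2 / 2) \<le> (1 + 9 / 10 * \<epsilon>) * ln (1 + s)"
    using s assms by (intro mult_left_mono ln_one_plus_ge) auto
  with 2 have 3: "s * (1 + \<epsilon> / 10) - (1 + 9 / 10 * \<epsilon>) * ln (1 + s) \<le> - (4 / 25) * \<epsilon>\<^sup>2" by linarith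
  have "(1 + s) powr (-(1 + 9 / 10 * \<epsilon>) * \<mu>) * (1 + s * p) ^ N
      \<le> exp (-(1 + 9 / 10 * \<epsilon>) * \<mu> * ln (1 + s)) * exp (s * (1 + \<epsilon> / 10) * \<mu>)"
    using s 1 by (simp add: powr_def)
  also have "\<dots> = exp ((s * (1 + \<epsilon> / 10) - (1 + 9 / 10 * \<epsilon>) * ln (1 + s)) * \<mu>)"
    by (simp add: exp_add[symmetric] algebra_simps)
  also have "\<dots> \<le> exp (- (4 / 25) * \<epsilon>\<^sup>2 * \<mu>)"
    using mult_right_mono[OF 3 \<mu>] by simp
  finally show ?thesis by (simp add: s_def \<mu>_def)
qed

lemma chernoff_lower:
  fixes \<epsilon> p q :: real and N :: nat
  assumes "0 < \<epsilon>" "\<epsilon> < 1" "p \<le> 1" "0 \<le> q" "(1 - \<epsilon> / 10) * q \<le> p"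
  shows "(1 + 2 * \<epsilon> / 5) powr ((1 - 9 / 10 * \<epsilon>) * (N * q)) * (1 + (1 / (1 + 2 * \<epsilon> / 5) - 1) * p) ^ N
    \<le> exp (- (4 / 25) * \<epsilon>\<^sup>2 * (N * q))"
proof -
  define s \<mu> t where "s = 2 * \<epsilon> / 5" and "\<mu> = N * q" and "t = s / (1 + s)"
  have s: "0 < s" and \<mu>: "0 \<le> \<mu>" using assms by (auto simp: s_def \<mu>_def)
  have t: "0 < t" "t \<le> 1" "s - s\<^sup>2 \<le> t"
    using s by (auto simp: t_def field_simps power2_eq_square)
  have c: "1 / (1 + s) - 1 = - t" using s by (simp add: t_def field_simps)
  have p: "0 \<le> p" using assms(2,4) by (intro order_trans[OF _ assms(5)] mult_nonneg_nonneg) auto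
  \<comment> \<open>Makes the base 1 - t p nonnegative, so that the bound by exp can be raised to
    the power \<open>N\<close>.\<close>
  have tp: "t * p \<le> 1" using t p assms by (intro mult_le_one) auto
  have "(1 + (- t) * p) ^ N \<le> exp (- t * p) ^ N"
    using tp exp_ge_add_one_self[of "- t * p"] by (intro power_mono) auto
  also have "\<dots> = exp (N * (- t * p))" by (simp only: exp_of_nat_mult)
  also have "\<dots> \<le> exp (- (1 - \<epsilon> / 10) * (s - s\<^sup>2) * \<mu>)"
  proof -
    have "(s - s\<^sup>2) * ((1 - \<epsilon> / 10) * q) \<le> t * ((1 - \<epsilon> / 10) * q)"
      using t assms by (intro mult_right_mono mult_nonneg_nonneg) auto
    also have "\<dots> \<le> t * p" using t assms by (intro mult_left_mono) auto
    finally have "N * ((s - s\<^sup>2) * ((1 - \<epsilon> / 10) * q)) \<le> N * (t * p)"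
      by (intro mult_left_mono) auto
    moreover have "N * ((s - s\<^sup>2) * ((1 - \<epsilon> / 10) * q)) = (1 - \<epsilon> / 10) * (s - s\<^sup>2) * \<mu>"
      by (simp add: \<mu>_def)
    ultimately have "(1 - \<epsilon> / 10) * (s - s\<^sup>2) * \<mu> \<le> N * (t * p)" by linarith
    then show ?thesis
      by (simp only: exp_le_cancel_iff mult_minus_left mult_minus_right neg_le_iff_le)
  qed
  finally have 1: "(1 + (- t) * p) ^ N \<le> exp (- (1 - \<epsilon> / 10) * (s - s\<^sup>2) * \<mu>)" .
  \<comment> \<open>Up to a cubic term of favourable sign the exponent is s^2 - (4/5) \<epsilon> s.
    Its minimiser is s = 2\<epsilon>/5, with value -(4/25) \<epsilon>^2; the upper tail shares this
    s.\<close>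
  have "0 \<le> \<epsilon> ^ 3" using assms by auto
  then have 2: "(1 - 9 / 10 * \<epsilon>) * s - (1 - \<epsilon> / 10) * (s - s\<^sup>2) \<le> - (4 / 25) * \<epsilon>\<^sup>2"
    by (simp add: s_def field_simps power2_eq_square power3_eq_cube)
  have "(1 - 9 / 10 * \<epsilon>) * ln (1 + s) \<le> (1 - 9 / 10 * \<epsilon>) * s"
    using s assms ln_add_one_self_le_self[of s] by (intro mult_left_mono) auto
  with 2 have 3: "(1 - 9 / 10 * \<epsilon>) * ln (1 + s) - (1 - \<epsilon> / 10) * (s - s\<^sup>2) \<le> - (4 / 25) * \<epsilon>\<^sup>2" by linarith
  have "(1 + s) powr ((1 - 9 / 10 * \<epsilon>) * \<mu>) * (1 + (- t) * p) ^ N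
      \<le> exp ((1 - 9 / 10 * \<epsilon>) * \<mu> * ln (1 + s)) * exp (- (1 - \<epsilon> / 10) * (s - s\<^sup>2) * \<mu>)"
    using s 1 by (simp add: powr_def)
  also have "\<dots> = exp (((1 - 9 / 10 * \<epsilon>) * ln (1 + s) - (1 - \<epsilon> / 10) * (s - s\<^sup>2)) * \<mu>)"
    by (simp add: exp_add[symmetric] algebra_simps)
  also have "\<dots> \<le> exp (- (4 / 25) * \<epsilon>\<^sup>2 * \<mu>)"
    using mult_right_mono[OF 3 \<mu>] by simp
  finally show ?thesis by (simp add: s_def[symmetric] \<mu>_def[symmetric] c)
qed

text \<open>\<open>m\<close> is the number of grid points per axis, the factor 2 stands for the two
  tails, and the -1 in the bound on \<mu> allows for rounding the number of points. From m \<le> 121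
  n^2/\<epsilon> \<le> (1280 n/\<epsilon>)^2 follows n ln m \<le> 2Q - 4, while the exponent gained
  is at least (4/25)(14Q - 1). The constant 14 exceeds 2 * 25/4 = 12.5, as this comparison requires
  for large Q.\<close>

lemma union_bound_lt_1:
  fixes \<epsilon> \<mu> Q :: real and n m :: nat
  assumes "0 < \<epsilon>" "\<epsilon> < 1" "1 \<le> n" "0 < m" and m: "m \<le> 120 * (real n)\<^sup>2 / \<epsilon> + 1"
    and \<mu>: "14 / \<epsilon>\<^sup>2 * Q - 1 \<le> \<mu>"
    and Q_def: "Q = real n * ln (real n) + real n * ln (1280 / \<epsilon>) + 2"
  shows "2 * real m ^ n * exp (- (4 / 25) * \<epsilon>\<^sup>2 * \<mu>) < 1"
proof -
  have n: "1 \<le> real n" using \<open>1 \<le> n\<close> by simp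
  have "1 \<le> (real n)\<^sup>2 / \<epsilon>" using one_le_power[OF n, of 2] \<open>0 < \<epsilon>\<close> \<open>\<epsilon> < 1\<close> by (simp add: le_divide_eq)
  then have "real m \<le> 121 * ((real n)\<^sup>2 / \<epsilon>)" using m by simp
  also have "\<dots> \<le> 1638400 * ((real n)\<^sup>2 / \<epsilon>\<^sup>2)"
  proof (intro mult_mono divide_left_mono)
    show "\<epsilon>\<^sup>2 \<le> \<epsilon>" using assms(1,2) by (simp add: power2_eq_square)
  qed (use assms(1,2) in auto)
  also have "\<dots> = (real n * (1280 / \<epsilon>))\<^sup>2" by (simp add: power2_eq_square field_simps)
  finally have "ln (real m) \<le> ln ((real n * (1280 / \<epsilon>))\<^sup>2)"
    using \<open>0 < m\<close> by (intro ln_mono) auto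
  also have "\<dots> = 2 * ln (real n * (1280 / \<epsilon>))"
    using n \<open>0 < \<epsilon>\<close> by (simp add: ln_realpow)
  also have "ln (real n * (1280 / \<epsilon>)) = ln (real n) + ln (1280 / \<epsilon>)"
    using n \<open>0 < \<epsilon>\<close> by (intro ln_mult_pos) auto
  finally have "real n * ln (real m) \<le> real n * (2 * (ln (real n) + ln (1280 / \<epsilon>)))"
    using n by (intro mult_left_mono) auto
  then have a: "real n * ln (real m) \<le> 2 * Q - 4" by (simp add: Q_def algebra_simps)
  have "0 \<le> ln (real n)" "0 \<le> ln (1280 / \<epsilon>)" using n assms(1,2) by auto
  then have Q: "2 \<le> Q" by (simp add: Q_def)
  have "\<epsilon>\<^sup>2 \<le> 1" using assms(1,2) by (simp add: power_le_one)
  have "\<epsilon>\<^sup>2 * (14 / \<epsilon>\<^sup>2 * Q - 1) \<le> \<epsilon>\<^sup>2 * \<mu>" using \<mu> by (intro mult_left_mono) auto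
  moreover have "\<epsilon>\<^sup>2 * (14 / \<epsilon>\<^sup>2 * Q - 1) = 14 * Q - \<epsilon>\<^sup>2" using \<open>0 < \<epsilon>\<close> by (simp add: field_simps)
  ultimately have b: "14 * Q - 1 \<le> \<epsilon>\<^sup>2 * \<mu>" using \<open>\<epsilon>\<^sup>2 \<le> 1\<close> by linarith
  have "exp (real n * ln (real m)) = real m ^ n"
    using \<open>0 < m\<close> by (subst exp_of_nat_mult) simp
  then have "2 * real m ^ n * exp (- (4 / 25) * \<epsilon>\<^sup>2 * \<mu>)
      = exp (ln 2) * exp (real n * ln (real m)) * exp (- (4 / 25) * \<epsilon>\<^sup>2 * \<mu>)"
    by simp
  also have "\<dots> = exp (ln 2 + real n * ln (real m) - (4 / 25) * (\<epsilon>\<^sup>2 * \<mu>))"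
    unfolding exp_add[symmetric] by simp
  also have "\<dots> < exp 0"
    using a b Q ln_2_less_1 by (intro exp_less_mono) linarith
  finally show ?thesis by simp
qed


section \<open>Convex bodies on the torus and equidistributed point sets\<close>

text \<open>Convexity gives K + \<delta> K \<subseteq> (1 + \<delta>) K, and the last hypothesis
  puts x - y into \<delta> K.\<close>

lemma translate_scaled_convex:
  fixes K :: "'a::real_vector set"
  assumes "convex K" "0 < \<delta>" "(1 / \<delta>) *\<^sub>R (x - y) \<in> K"
  shows "(\<lambda>u. x + u) ` K \<subseteq> (\<lambda>u. y + (1 + \<delta>) *\<^sub>R u) ` K"
proof safe
  fix u assume u: "u \<in> K"
  let ?u = "(1 / (1 + \<delta>)) *\<^sub>R u + (\<delta> / (1 + \<delta>)) *\<^sub>R ((1 / \<delta>) *\<^sub>R (x - y))"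
  have "?u \<in> K" using assms u
    by (intro convexD) (auto simp: add_divide_distrib[symmetric])
  moreover have "(1 + \<delta>) *\<^sub>R ?u = u + (x - y)"
    using assms(2) by (simp add: scaleR_add_right)
  ultimately show "x + u \<in> (\<lambda>u. y + (1 + \<delta>) *\<^sub>R u) ` K"
    by (intro image_eqI[of _ _ ?u]) auto
qed

text \<open>Here the inclusion behind it is (1 - \<delta>) K + \<delta> K \<subseteq> K, with y - x
  in \<delta> K.\<close>

lemma scaled_convex_translate:
  fixes K :: "'a::real_vector set"
  assumes "convex K" "0 < \<delta>" "\<delta> < 1" "(1 / \<delta>) *\<^sub>R (y - x) \<in> K"
  shows "(\<lambda>u. y + (1 - \<delta>) *\<^sub>R u) ` K \<subseteq> (\<lambda>u. x + u) ` K"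
proof safe
  fix u assume u: "u \<in> K"
  let ?u = "(1 - \<delta>) *\<^sub>R u + \<delta> *\<^sub>R ((1 / \<delta>) *\<^sub>R (y - x))"
  have "?u \<in> K" using assms u by (intro convexD) auto
  moreover have "y + (1 - \<delta>) *\<^sub>R u = x + ?u" using assms(2) by simp
  ultimately show "y + (1 - \<delta>) *\<^sub>R u \<in> (\<lambda>u. x + u) ` K" by blast
qed

lemma bounded_if_components_le:
  fixes K :: "(real ^ 'n) set"
  assumes "\<And>u i. u \<in> K \<Longrightarrow> \<bar>u $ i\<bar> \<le> b"
  shows "bounded K"
proof (rule bounded_subset[OF bounded_cbox])
  show "K \<subseteq> cbox (\<chi> i. - b) (\<chi> i. b)"
    using assms by (auto simp: mem_box_cart abs_le_iff minus_le_iff)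
qed

lemma prob_space_unit_cell: "prob_space (lebesgue_on (unit_cell :: (real ^ 'n) set))"
  using lmeasurable_unit_cell measure_unit_cell
  by (intro prob_space_restrict_space) (auto simp: fmeasurableD emeasure_eq_measure2)

text \<open>Two points of \<open>K\<close> differ by at most 4/5 in each coordinate, hence by less
  than 1 after scaling by t < 5/4. So the scaled translate embeds into the torus and keeps its
  volume.\<close>

lemma
  fixes K :: "(real ^ 'n) set" and y :: "real ^ 'n"
  assumes "convex K" "\<And>u i. u \<in> K \<Longrightarrow> \<bar>u $ i\<bar> \<le> 2 / 5" "0 \<le> t" "t < 5 / 4"
  defines "W \<equiv> (\<lambda>u. y + t *\<^sub>R u) ` K"
  shows inj_on_vfrac_scaled: "inj_on vfrac W"
    and lmeasurable_vfrac_scaled: "vfrac ` W \<in> lmeasurable"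
    and measure_vfrac_scaled: "measure lebesgue (vfrac ` W) = t ^ CARD('n) * measure lebesgue K"
proof -
  have "bounded K"
    using assms(2) by (rule bounded_if_components_le)
  then have "bounded ((+) y ` ((\<lambda>u. t *\<^sub>R u) ` K))" by (intro bounded_translation bounded_scaling)
  then have bW: "bounded W" by (simp add: W_def image_image)
  have W: "W \<in> lmeasurable"
    unfolding W_def by (intro measurable_convex convex_affinity assms(1) bW[unfolded W_def])
  have "measure lebesgue W = t ^ CARD('n) * measure lebesgue K"
    using measure_lebesgue_affine[of t y K] assms by (simp add: W_def add.commute)
  moreover show inj: "inj_on vfrac W"
  proof (rule inj_on_vfrac)
    fix u v i assume "u \<in> W" "v \<in> W"
    then obtain a b where ab: "a \<in> K" "b \<in> K" "u = y + t *\<^sub>R a" "v = y + t *\<^sub>R b"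
      by (auto simp: W_def)
    then have "\<bar>u $ i - v $ i\<bar> = t * \<bar>a $ i - b $ i\<bar>"
      using assms(3) by (simp add: abs_mult right_diff_distrib[symmetric])
    also have "\<dots> \<le> t * (4 / 5)"
      using assms(2)[OF ab(1), of i] assms(2)[OF ab(2), of i] assms(3)
      by (intro mult_left_mono) linarith+
    finally show "\<bar>u $ i - v $ i\<bar> < 1" using assms(4) by simp
  qed
  ultimately show "vfrac ` W \<in> lmeasurable" "measure lebesgue (vfrac ` W) = t ^ CARD('n) * measure lebesgue K"
    using lmeasurable_vfrac_image[OF W bW] measure_vfrac_image[OF W bW] by auto
qed

text \<open>The theorem for a normalised body on the torus. As the torus has volume 1,
  \<open>card P * vol K\<close> is the mean count over all translates.\<close>

lemma exists_equidistributed_points: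
  fixes K :: "(real ^ 'n) set" and \<epsilon> :: real
  defines "n \<equiv> real CARD('n)"
  assumes \<epsilon>: "0 < \<epsilon>" "\<epsilon> < 1" and K: "convex K"
    and sub: "\<And>u i. u \<in> K \<Longrightarrow> \<bar>u $ i\<bar> \<le> 2 / 5"
    and sup: "\<And>u. (\<And>i. \<bar>u $ i\<bar> < 1 / (6 * n)) \<Longrightarrow> u \<in> K"
  shows "\<exists>P\<subseteq>unit_cell. finite P \<and> P \<noteq> {} \<and>
      card P * vol K \<le> 14 / \<epsilon>\<^sup>2 * (n * ln n + n * ln (1280 / \<epsilon>) + 2) \<and>
      (\<forall>x. \<bar>card (P \<inter> vfrac ` ((+) x ` K)) - card P * vol K\<bar> \<le> 9 / 10 * \<epsilon> * (card P * vol K))"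
proof -
  define B where "B = 14 / \<epsilon>\<^sup>2 * (n * ln n + n * ln (1280 / \<epsilon>) + 2)"
  define q where "q = vol K"
  define \<delta> where "\<delta> = \<epsilon> / (20 * n)"
  \<comment> \<open>Chosen so that 1/m \<le> \<delta>/(6n): the error of rounding to the grid,
    divided by \<delta>, stays in the cube inside \<open>K\<close>.\<close>
  define m where "m = nat \<lceil>120 * n\<^sup>2 / \<epsilon>\<rceil>"
  \<comment> \<open>Rounding down keeps N q \<le> B, the density bound to be met, and loses at most
    q, which is at most 1 because \<open>K\<close> embeds into the unit cell.\<close>
  define N where "N = nat \<lfloor>B / q\<rfloor>"
  define s where "s = 2 * \<epsilon> / 5"
  define \<mu> where "\<mu> = N * q"
  have n: "1 \<le> n" by (simp add: n_def Suc_le_eq)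
  have \<delta>: "0 < \<delta>" "\<delta> \<le> \<epsilon> / 20" "\<delta> \<le> 1 / 20" "n * \<delta> = \<epsilon> / 20"
  proof -
    show "0 < \<delta>" "n * \<delta> = \<epsilon> / 20" using n \<epsilon> by (auto simp: \<delta>_def)
    show "\<delta> \<le> \<epsilon> / 20" using n \<epsilon> by (simp add: \<delta>_def field_simps)
    with \<epsilon> show "\<delta> \<le> 1 / 20" by simp
  qed
  have m_ge: "120 * n\<^sup>2 / \<epsilon> \<le> m" unfolding m_def by linarith
  have "0 < 120 * n\<^sup>2 / \<epsilon>" using n \<epsilon> by auto
  with m_ge have m: "0 < m" by linarith
  have m_le: "m \<le> 120 * n\<^sup>2 / \<epsilon> + 1"
    using \<open>0 < 120 * n\<^sup>2 / \<epsilon>\<close> unfolding m_def by linarith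
  have s: "0 < s" using \<epsilon> by (simp add: s_def)
  have bK: "bounded K"
    using sub by (rule bounded_if_components_le)
  have Km: "K \<in> lmeasurable" by (intro measurable_convex K bK)
  interpret prob_space "lebesgue_on (unit_cell :: (real ^ 'n) set)" by (rule prob_space_unit_cell)
  have Um: "(unit_cell :: (real ^ 'n) set) \<in> sets lebesgue"
    by (intro fmeasurableD lmeasurable_unit_cell)
  define A where "A = (\<lambda>t y. vfrac ` ((\<lambda>u. y + t *\<^sub>R u) ` K))"
  have A_sub: "A t y \<subseteq> unit_cell" for t y by (auto simp: A_def vfrac_in_unit_cell)
  have A_ev: "A t y \<in> events" and A_prob: "prob (A t y) = t ^ CARD('n) * q"
    if "0 \<le> t" "t < 5 / 4" for t y
  proof -
    have lm: "A t y \<in> lmeasurable" and vA: "vol (A t y) = t ^ CARD('n) * q"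
      using lmeasurable_vfrac_scaled[OF K sub that] measure_vfrac_scaled[OF K sub that] by (auto simp: A_def q_def)
    show "A t y \<in> events"
      using A_sub[of t y] fmeasurableD[OF lm] Um
      by (simp add: sets_restrict_space_iff)
    show "prob (A t y) = t ^ CARD('n) * q"
      using A_sub[of t y] Um vA by (simp add: measure_restrict_space)
  qed
  have q1: "q \<le> 1" using A_prob[of 1 0] prob_le_1[of "A 1 0"] by simp
  have q0: "0 < q"
  proof -
    let ?U = "box (- (\<chi> i. 1 / (6 * n))) (\<chi> i. 1 / (6 * n)) :: (real ^ 'n) set"
    have "?U \<subseteq> K" using sup by (auto simp: mem_box_cart abs_less_iff) (smt (verit))
    moreover have "0 \<in> ?U" using n by (simp add: mem_box_cart)
    ultimately have "0 \<in> interior K" by (meson interior_maximal open_box subsetD)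
    then have "\<not> negligible K" using negligible_convex_interior[OF K] by blast
    then show ?thesis
      using Km unfolding q_def negligible_iff_measure by (simp add: zero_less_measure_iff)
  qed
  define G :: "(real ^ 'n) set" where "G = (\<lambda>k. \<chi> i. real (k i) / m) ` (UNIV \<rightarrow>\<^sub>E {..<m})"
  have finG: "finite G" unfolding G_def by (intro finite_imageI finite_PiE) auto
  have cardG: "card G \<le> m ^ CARD('n)"
    unfolding G_def by (rule order_trans[OF card_image_le]) (auto intro!: finite_PiE simp: card_PiE)
  define t where "t = (\<lambda>b. if b then 1 + \<delta> else 1 - \<delta>)"
  have t: "0 \<le> t b" "t b < 5 / 4" for b using \<delta> by (auto simp: t_def)
  define c where "c = (\<lambda>b. if b then 1 + s else 1 / (1 + s))"
  \<comment> \<open>With these weights \<open>w b * c b ^ k < 1\<close> says exactly that k is below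
    (1 + 9\<epsilon>/10) \<mu> if \<open>b\<close>, and above (1 - 9\<epsilon>/10) \<mu> otherwise.
    All terms are positive, so a total below 1 excludes every bad event at once.\<close>
  define w where "w = (\<lambda>b. if b then (1 + s) powr (-(1 + 9 / 10 * \<epsilon>) * \<mu>) else (1 + s) powr ((1 - 9 / 10 * \<epsilon>) * \<mu>))"
  have singles: "{p} \<in> null_sets (lebesgue_on (unit_cell :: (real ^ 'n) set))" if "p \<in> unit_cell" for p
    using that Um by (simp add: null_sets_restrict_space)
  obtain P where P: "P \<subseteq> unit_cell" "finite P" "card P = N"
    and pot: "(\<Sum>j\<in>G \<times> UNIV. w (snd j) * c (snd j) ^ card (P \<inter> A (t (snd j)) (fst j)))
      \<le> (\<Sum>j\<in>G \<times> UNIV. w (snd j) * (1 + (c (snd j) - 1) * prob (A (t (snd j)) (fst j))) ^ N)"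
    using exists_low_potential[where J = "G \<times> UNIV" and A = "\<lambda>j. A (t (snd j)) (fst j)"
        and w = "\<lambda>j. w (snd j)" and c = "\<lambda>j. c (snd j)" and N = N]
      A_ev[OF t] singles by (auto simp: space_restrict_space)
  have bern: "1 - \<epsilon> / 20 \<le> (1 - \<delta>) ^ CARD('n)"
    using Bernoulli_inequality[of "- \<delta>" "CARD('n)"] \<delta> by (simp add: n_def)
  \<comment> \<open>Bernoulli's inequality bounds powers from below only. The upper bound follows
    from (1 + \<delta>)^n (1 - \<delta>)^n \<le> 1 and 1 \<le> (1 + \<epsilon>/10)(1 -
    \<epsilon>/20).\<close>
  have up: "(1 + \<delta>) ^ CARD('n) \<le> 1 + \<epsilon> / 10"
  proof -
    have "(1 + \<delta>) ^ CARD('n) * (1 - \<epsilon> / 20) \<le> (1 + \<delta>) ^ CARD('n) * (1 - \<delta>) ^ CARD('n)"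
      using bern \<delta> by (intro mult_left_mono) auto
    also have "\<dots> = (1 - \<delta>\<^sup>2) ^ CARD('n)"
      by (simp add: power_mult_distrib[symmetric] power2_eq_square algebra_simps)
    also have "\<dots> \<le> 1" using \<delta> by (intro power_le_one) (auto simp: power_le_one abs_square_le_1)
    also have "1 \<le> (1 + \<epsilon> / 10) * (1 - \<epsilon> / 20)"
      using \<epsilon> by (simp add: algebra_simps)
    finally show ?thesis using \<epsilon> by simp
  qed
  have each: "w b * (1 + (c b - 1) * prob (A (t b) y)) ^ N \<le> exp (- (4 / 25) * \<epsilon>\<^sup>2 * \<mu>)" for b y
  proof (cases b)
    case True
    have "w b * (1 + (c b - 1) * prob (A (t b) y)) ^ N
        = (1 + 2 * \<epsilon> / 5) powr (-(1 + 9 / 10 * \<epsilon>) * (N * q)) * (1 + 2 * \<epsilon> / 5 * prob (A (t b) y)) ^ N"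
      using True by (simp add: w_def c_def s_def \<mu>_def)
    also have "\<dots> \<le> exp (- (4 / 25) * \<epsilon>\<^sup>2 * (N * q))"
    proof (rule chernoff_upper)
      show "prob (A (t b) y) \<le> (1 + \<epsilon> / 10) * q"
        using True up q0 A_prob[OF t, of True y] by (simp add: t_def)
    qed (use \<epsilon> q0 in auto)
    finally show ?thesis by (simp add: \<mu>_def)
  next
    case False
    have "w b * (1 + (c b - 1) * prob (A (t b) y)) ^ N
        = (1 + 2 * \<epsilon> / 5) powr ((1 - 9 / 10 * \<epsilon>) * (N * q)) * (1 + (1 / (1 + 2 * \<epsilon> / 5) - 1) * prob (A (t b) y)) ^ N"
      using False by (simp add: w_def c_def s_def \<mu>_def)
    also have "\<dots> \<le> exp (- (4 / 25) * \<epsilon>\<^sup>2 * (N * q))"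
    proof (rule chernoff_lower)
      show "(1 - \<epsilon> / 10) * q \<le> prob (A (t b) y)"
        using False bern q0 \<epsilon> A_prob[OF t, of False y] by (simp add: t_def mult_right_mono)
    qed (use \<epsilon> q0 in auto)
    finally show ?thesis by (simp add: \<mu>_def)
  qed
  have Bq: "0 \<le> B"
    unfolding B_def using n \<epsilon> by (intro mult_nonneg_nonneg add_nonneg_nonneg) auto
  have "real N \<le> B / q" "B / q - 1 \<le> real N"
    using Bq q0 divide_nonneg_pos[OF Bq q0] unfolding N_def by linarith+
  then have \<mu>_le: "\<mu> \<le> B" and \<mu>_ge: "B - q \<le> \<mu>"
    using q0 by (auto simp: \<mu>_def field_simps)
  have sum_lt: "(\<Sum>j\<in>G \<times> UNIV. w (snd j) * c (snd j) ^ card (P \<inter> A (t (snd j)) (fst j))) < 1"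
  proof -
    note pot
    also have "(\<Sum>j\<in>G \<times> UNIV. w (snd j) * (1 + (c (snd j) - 1) * prob (A (t (snd j)) (fst j))) ^ N)
        \<le> card (G \<times> (UNIV :: bool set)) * exp (- (4 / 25) * \<epsilon>\<^sup>2 * \<mu>)"
      by (rule sum_bounded_above) (rule each)
    also have "\<dots> \<le> 2 * real m ^ CARD('n) * exp (- (4 / 25) * \<epsilon>\<^sup>2 * \<mu>)"
    proof (rule mult_right_mono)
      have "real (card G) \<le> real (m ^ CARD('n))" using cardG by (rule of_nat_mono)
      then show "real (card (G \<times> (UNIV :: bool set))) \<le> 2 * real m ^ CARD('n)" by (simp add: card_cartesian_product)
    qed auto
    also have "\<dots> < 1"
      using \<epsilon> m m_le \<mu>_ge q1 by (intro union_bound_lt_1) (auto simp: n_def B_def Suc_le_eq)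
    finally show ?thesis .
  qed
  have wpos: "0 < w b" "0 < c b" for b using s by (auto simp: w_def c_def)
  have lt1: "w b * c b ^ card (P \<inter> A (t b) y) < 1" if "y \<in> G" for b y
  proof -
    have "w (snd (y, b)) * c (snd (y, b)) ^ card (P \<inter> A (t (snd (y, b))) (fst (y, b)))
      \<le> (\<Sum>j\<in>G \<times> UNIV. w (snd j) * c (snd j) ^ card (P \<inter> A (t (snd j)) (fst j)))"
      using that finG wpos by (intro member_le_sum) (auto intro!: mult_nonneg_nonneg simp: less_imp_le)
    with sum_lt show ?thesis by simp
  qed
  have cnt_up: "card (P \<inter> A (1 + \<delta>) y) < (1 + 9 / 10 * \<epsilon>) * \<mu>" if "y \<in> G" for y
  proof -
    have "(1 + s) powr (-(1 + 9 / 10 * \<epsilon>) * \<mu>) * (1 + s) powr card (P \<inter> A (1 + \<delta>) y) < 1"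
      using lt1[OF that, of True] s by (simp add: w_def c_def t_def powr_realpow)
    then have "(1 + s) powr (-(1 + 9 / 10 * \<epsilon>) * \<mu> + card (P \<inter> A (1 + \<delta>) y)) < (1 + s) powr 0"
      using s by (simp add: powr_add)
    then have "-(1 + 9 / 10 * \<epsilon>) * \<mu> + card (P \<inter> A (1 + \<delta>) y) < 0"
      using s by (subst (asm) powr_less_cancel_iff) auto
    then show ?thesis by (simp add: algebra_simps)
  qed
  have cnt_low: "(1 - 9 / 10 * \<epsilon>) * \<mu> < card (P \<inter> A (1 - \<delta>) y)" if "y \<in> G" for y
  proof -
    have "(1 + s) powr ((1 - 9 / 10 * \<epsilon>) * \<mu>) / (1 + s) powr card (P \<inter> A (1 - \<delta>) y) < 1"
      using lt1[OF that, of False] s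
      by (simp add: w_def c_def t_def powr_realpow power_one_over)
    then have "(1 + s) powr ((1 - 9 / 10 * \<epsilon>) * \<mu> - card (P \<inter> A (1 - \<delta>) y)) < (1 + s) powr 0"
      using s by (simp add: powr_diff)
    then have "(1 - 9 / 10 * \<epsilon>) * \<mu> - card (P \<inter> A (1 - \<delta>) y) < 0"
      using s by (subst (asm) powr_less_cancel_iff) auto
    then show ?thesis by simp
  qed
  have main: "\<bar>card (P \<inter> vfrac ` ((+) x ` K)) - \<mu>\<bar> \<le> 9 / 10 * \<epsilon> * \<mu>" for x
  proof -
    define z where "z = vfrac x"
    define k where "k = (\<lambda>i. nat \<lfloor>m * z $ i\<rfloor>)"
    define y :: "real ^ 'n" where "y = (\<chi> i. real (k i) / m)"
    have zi: "0 \<le> z $ i" "z $ i < 1" for i using vfrac_in_unit_cell[of x] by (auto simp: z_def unit_cell_def)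
    have ki: "real (k i) \<le> m * z $ i" "m * z $ i < real (k i) + 1" for i
      using mult_nonneg_nonneg[OF _ zi(1), of "real m" i] unfolding k_def by linarith+
    have "k i < m" for i
    proof -
      have "real m * z $ i < real m * 1" using zi(2)[of i] m by (intro mult_strict_left_mono) auto
      then show ?thesis using ki(1)[of i] by linarith
    qed
    then have "y \<in> G" unfolding G_def y_def by (intro imageI) auto
    have close: "0 \<le> z $ i - y $ i" "z $ i - y $ i < 1 / m" for i
    proof -
      have zy: "z $ i - y $ i = (m * z $ i - k i) / m" using m by (simp add: y_def diff_divide_distrib)
      show "0 \<le> z $ i - y $ i" unfolding zy using ki[of i] by simp
      show "z $ i - y $ i < 1 / m" unfolding zy using ki[of i] m by (intro divide_strict_right_mono) auto
    qed
    have small: "\<bar>(1 / \<delta>) * (z $ i - y $ i)\<bar> < 1 / (6 * n)" for i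
    proof -
      have "\<bar>(1 / \<delta>) * (z $ i - y $ i)\<bar> = (1 / \<delta>) * (z $ i - y $ i)"
        using close[of i] \<delta> by simp
      also have "\<dots> < (1 / \<delta>) * (1 / m)"
        using close[of i] \<delta> by (intro mult_strict_left_mono) auto
      also have "\<dots> \<le> 1 / (6 * n)"
        using m_ge n \<epsilon> m by (simp add: \<delta>_def field_simps power2_eq_square)
      finally show ?thesis .
    qed
    \<comment> \<open>The inner cube is symmetric about 0, so one grid vector serves both the
      enlarged and the shrunken body.\<close>
    have in1: "(1 / \<delta>) *\<^sub>R (z - y) \<in> K"
      using small by (intro sup) auto
    have in2: "(1 / \<delta>) *\<^sub>R (y - z) \<in> K"
      using small by (intro sup) (auto simp: abs_mult abs_minus_commute)
    have eq: "vfrac ` ((+) x ` K) = vfrac ` ((\<lambda>u. z + u) ` K)"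
      using vfrac_image_translate[of x K] by (simp add: z_def)
    have "vfrac ` ((+) x ` K) \<subseteq> A (1 + \<delta>) y"
      unfolding eq A_def by (intro image_mono translate_scaled_convex K \<delta> in1)
    then have "card (P \<inter> vfrac ` ((+) x ` K)) \<le> card (P \<inter> A (1 + \<delta>) y)"
      using P by (intro card_mono) auto
    then have "card (P \<inter> vfrac ` ((+) x ` K)) \<le> (1 + 9 / 10 * \<epsilon>) * \<mu>"
      using cnt_up[OF \<open>y \<in> G\<close>] by linarith
    moreover have "A (1 - \<delta>) y \<subseteq> vfrac ` ((+) x ` K)"
      unfolding eq A_def using \<delta> by (intro image_mono scaled_convex_translate K in2) auto
    then have "card (P \<inter> A (1 - \<delta>) y) \<le> card (P \<inter> vfrac ` ((+) x ` K))"
      using P by (intro card_mono) auto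
    then have "(1 - 9 / 10 * \<epsilon>) * \<mu> \<le> card (P \<inter> vfrac ` ((+) x ` K))"
      using cnt_low[OF \<open>y \<in> G\<close>] by linarith
    ultimately show ?thesis unfolding abs_le_iff by (auto simp: algebra_simps)
  qed
  \<comment> \<open>Needed for a positive density, by which \<open>eta\<close> divides. It holds
    because B \<ge> 28, while rounding costs at most 1.\<close>
  have "P \<noteq> {}"
  proof
    assume "P = {}"
    then have "N = 0" using P by simp
    then have "\<mu> = 0" by (simp add: \<mu>_def)
    have "14 * 2 \<le> B"
    proof -
      have "14 \<le> 14 / \<epsilon>\<^sup>2" using \<epsilon> by (simp add: le_divide_eq power_le_one)
      moreover have "2 \<le> n * ln n + n * ln (1280 / \<epsilon>) + 2"
        using n \<epsilon> by (intro add_increasing add_nonneg_nonneg) auto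
      ultimately show ?thesis unfolding B_def by (intro mult_mono) auto
    qed
    with \<mu>_ge q1 \<open>\<mu> = 0\<close> show False by linarith
  qed
  with P \<mu>_le main show ?thesis
    unfolding B_def[symmetric] q_def[symmetric] by (intro exI[of _ P]) (simp add: \<mu>_def)
qed


section \<open>Periodic point sets and their density\<close>

lemma vfrac_unit_cell_add: "v \<in> unit_cell \<Longrightarrow> vfrac (v + vfloor u) = v"
  by (simp add: vfrac_add_vfloor vfrac_unit_cell)

lemma vfloor_unit_cell_add: "v \<in> unit_cell \<Longrightarrow> vfloor (v + vfloor u) = vfloor u"
  by (simp add: vfloor_eq_iff)

lemma finite_vfrac_fibre:
  assumes "finite P" "bounded W"
  shows "finite (vfrac -` P \<inter> W)"
proof -
  have "vfrac -` P \<inter> W \<subseteq> (\<lambda>(p, z). p + z) ` (P \<times> vfloor ` W)"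
  proof
    fix v assume "v \<in> vfrac -` P \<inter> W"
    moreover have "v = vfrac v + vfloor v" by (simp add: vfrac_eq)
    ultimately show "v \<in> (\<lambda>(p, z). p + z) ` (P \<times> vfloor ` W)"
      by (intro image_eqI[of _ _ "(vfrac v, vfloor v)"]) auto
  qed
  then show ?thesis
    by (rule finite_subset) (intro finite_imageI finite_cartesian_product assms finite_vfloor_image)
qed

text \<open>The library computes the factor as a determinant, but only for a well-ordered index type.\<close>

lemma linear_image_scales_measure:
  fixes g :: "real ^ 'n \<Rightarrow> real ^ 'n"
  assumes "linear g"
  shows "\<exists>\<kappa>. \<forall>S\<in>lmeasurable. g ` S \<in> lmeasurable \<and> vol (g ` S) = \<kappa> * vol S"
  using assms
proof (rule induct_linear_elementary)
  fix f g :: "real ^ 'n \<Rightarrow> real ^ 'n"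
  assume "\<exists>\<kappa>. \<forall>S\<in>lmeasurable. f ` S \<in> lmeasurable \<and> vol (f ` S) = \<kappa> * vol S"
    and "\<exists>\<kappa>. \<forall>S\<in>lmeasurable. g ` S \<in> lmeasurable \<and> vol (g ` S) = \<kappa> * vol S"
  then obtain a b where "\<forall>S\<in>lmeasurable. f ` S \<in> lmeasurable \<and> vol (f ` S) = a * vol S"
    "\<forall>S\<in>lmeasurable. g ` S \<in> lmeasurable \<and> vol (g ` S) = b * vol S" by blast
  then have "\<forall>S\<in>lmeasurable. (f \<circ> g) ` S \<in> lmeasurable \<and> vol ((f \<circ> g) ` S) = (a * b) * vol S"
    unfolding image_comp[symmetric] by (simp add: mult.assoc)
  then show "\<exists>\<kappa>. \<forall>S\<in>lmeasurable. (f \<circ> g) ` S \<in> lmeasurable \<and> vol ((f \<circ> g) ` S) = \<kappa> * vol S" ..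
next
  fix f :: "real ^ 'n \<Rightarrow> real ^ 'n" and i
  assume f: "linear f" "\<And>x. f x $ i = 0"
  have "negligible (f ` S)" for S
    by (rule negligible_subset[OF negligible_standard_hyperplane_cart[of i]]) (use f(2) in auto)
  then have "\<forall>S\<in>lmeasurable. f ` S \<in> lmeasurable \<and> vol (f ` S) = 0 * vol S"
    by (auto simp: negligible_iff_measure)
  then show "\<exists>\<kappa>. \<forall>S\<in>lmeasurable. f ` S \<in> lmeasurable \<and> vol (f ` S) = \<kappa> * vol S" ..
next
  fix c :: "'n \<Rightarrow> real"
  show "\<exists>\<kappa>. \<forall>S\<in>lmeasurable. (\<lambda>x. \<chi> i. c i * x $ i) ` S \<in> lmeasurable \<and>
      vol ((\<lambda>x. \<chi> i. c i * x $ i) ` S) = \<kappa> * vol S"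
    using measurable_stretch measure_stretch by blast
next
  fix m n :: 'n assume "m \<noteq> n"
  let ?t = "Transposition.transpose m n" and ?f = "\<lambda>x :: real ^ 'n. \<chi> i. x $ Transposition.transpose m n i"
  have lin: "linear ?f" by (rule linearI) (simp_all add: vec_eq_iff)
  \<comment> \<open>By \<open>measure_linear_sufficient\<close> it is enough to know the factor on
    boxes.\<close>
  have "vol (?f ` cbox a b) = 1 * vol (cbox a b)" for a b
  proof (cases "cbox a b = {}")
    case True
    then show ?thesis unfolding True by simp
  next
    case False
    have "?f ` cbox a b = cbox (?f a) (?f b)"
    proof (intro equalityI subsetI)
      fix x assume x: "x \<in> cbox (?f a) (?f b)"
      have "a $ i \<le> x $ ?t i \<and> x $ ?t i \<le> b $ i" for i
        using x[unfolded mem_box_cart, rule_format, of "?t i"] by simp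
      then have "?f x \<in> cbox a b" by (simp add: mem_box_cart)
      moreover have "x = ?f (?f x)" by (simp add: vec_eq_iff)
      ultimately show "x \<in> ?f ` cbox a b" by blast
    qed (auto simp: mem_box_cart)
    moreover from False have "?f ` cbox a b \<noteq> {}" by simp
    moreover have "(\<Prod>i\<in>UNIV. ?f b $ i - ?f a $ i) = (\<Prod>i\<in>UNIV. b $ i - a $ i)"
      by (rule prod.reindex_bij_witness[of _ ?t ?t]) auto
    ultimately show ?thesis using False by (simp add: content_cbox_cart)
  qed
  then have suff: "?f ` S \<in> lmeasurable \<and> 1 * vol S = vol (?f ` S)" if "S \<in> lmeasurable" for S
    by (rule measure_linear_sufficient[OF lin that])
  have "\<forall>S\<in>lmeasurable. ?f ` S \<in> lmeasurable \<and> vol (?f ` S) = 1 * vol S"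
  proof (intro ballI conjI)
    fix S :: "(real ^ 'n) set" assume "S \<in> lmeasurable"
    from suff[OF this] show "?f ` S \<in> lmeasurable" "vol (?f ` S) = 1 * vol S" by (auto simp only:)
  qed
  then show "\<exists>\<kappa>. \<forall>S\<in>lmeasurable. ?f ` S \<in> lmeasurable \<and> vol (?f ` S) = \<kappa> * vol S" ..
next
  fix m n :: 'n assume "m \<noteq> n"
  let ?f = "\<lambda>x :: real ^ 'n. \<chi> i. if i = m then x $ m + x $ n else x $ i"
  have lin: "linear ?f" by (rule linearI) (simp_all add: vec_eq_iff algebra_simps)
  have "vol (?f ` cbox a b) = 1 * vol (cbox a b)" for a b
  proof (cases "cbox a b = {}")
    case True
    then show ?thesis unfolding True by simp
  next
    case False
    \<comment> \<open>Moving the lower corner to 0 meets the sign condition on that corner in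
      \<open>measure_shear_interval\<close>.\<close>
    have e: "cbox a b = (+) a ` cbox 0 (b - a)" using cbox_translation[of a 0 "b - a"] by simp
    with False have ne: "cbox 0 (b - a) \<noteq> {}" by auto
    have "?f ` (+) a ` cbox 0 (b - a) = (+) (?f a) ` ?f ` cbox 0 (b - a)"
      unfolding image_image linear_add[OF lin] ..
    then have "vol (?f ` cbox a b) = vol (?f ` cbox 0 (b - a))"
      by (simp only: e measure_translation)
    also have "\<dots> = vol (cbox 0 (b - a))" using \<open>m \<noteq> n\<close> ne by (intro measure_shear_interval) auto
    also have "\<dots> = vol (cbox a b)" by (simp only: e measure_translation)
    finally show ?thesis by simp
  qed
  then have suff: "?f ` S \<in> lmeasurable \<and> 1 * vol S = vol (?f ` S)" if "S \<in> lmeasurable" for S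
    by (rule measure_linear_sufficient[OF lin that])
  have "\<forall>S\<in>lmeasurable. ?f ` S \<in> lmeasurable \<and> vol (?f ` S) = 1 * vol S"
  proof (intro ballI conjI)
    fix S :: "(real ^ 'n) set" assume "S \<in> lmeasurable"
    from suff[OF this] show "?f ` S \<in> lmeasurable" "vol (?f ` S) = 1 * vol S" by (auto simp only:)
  qed
  then show "\<exists>\<kappa>. \<forall>S\<in>lmeasurable. ?f ` S \<in> lmeasurable \<and> vol (?f ` S) = \<kappa> * vol S" ..
qed

lemma bounded_linear_vimage:
  fixes g :: "'a::euclidean_space \<Rightarrow> 'b::euclidean_space"
  assumes "linear g" "inj g" "bounded S"
  shows "bounded (g -` S)"
proof -
  obtain B where B: "0 < B" "\<And>x. B * norm x \<le> norm (g x)"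
    using linear_inj_bounded_below_pos[OF assms(1,2)] by blast
  obtain a where a: "\<And>y. y \<in> S \<Longrightarrow> norm y \<le> a" using assms(3) by (auto simp: bounded_iff)
  have "norm x \<le> a / B" if "g x \<in> S" for x
    using order_trans[OF B(2) a[OF that]] B(1) by (simp add: field_simps)
  then show ?thesis by (auto simp: bounded_iff)
qed

text \<open>Attach to every counted point the image under \<open>g\<close> of its lattice cell.
  These images are disjoint, have volume \<kappa> and diameter at most \<open>R\<close>; so together
  they cover the ball of radius T - R and stay inside the ball of radius T + R.\<close>

lemma card_lattice_points_ball:
  fixes g :: "real ^ 'n \<Rightarrow> real ^ 'n" and p :: "real ^ 'n"
  assumes g: "linear g" "inj g" and \<kappa>: "\<And>S. S \<in> lmeasurable \<Longrightarrow> g ` S \<in> lmeasurable"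
    "\<And>S. S \<in> lmeasurable \<Longrightarrow> vol (g ` S) = \<kappa> * vol S"
    and p: "p \<in> unit_cell"
    and R: "\<And>u v. u \<in> unit_cell \<Longrightarrow> v \<in> unit_cell \<Longrightarrow> norm (g (u - v)) \<le> R"
  defines "E \<equiv> \<lambda>T. vfrac -` {p} \<inter> g -` cball 0 T"
  shows "vol (cball (0 :: real ^ 'n) (T - R)) \<le> \<kappa> * card (E T)" (is ?lower)
    and "\<kappa> * card (E T) \<le> vol (cball (0 :: real ^ 'n) (T + R))" (is ?upper)
proof -
  have bij: "bij g" using g linear_injective_imp_surjective[OF g] by (simp add: bij_def)
  have gdiff: "g (u - v) = g u - g v" for u v by (rule linear_diff[OF g(1)])
  have "bounded (g -` cball 0 T)" by (intro bounded_linear_vimage g bounded_cball)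
  then have fin: "finite (E T)" unfolding E_def by (intro finite_vfrac_fibre) auto
  define C where "C = (\<lambda>v. g ` (+) (vfloor v) ` unit_cell)"
  have Cm: "C v \<in> lmeasurable" "vol (C v) = \<kappa>" for v
  proof -
    have "(+) (vfloor v) ` unit_cell \<in> lmeasurable"
      by (intro measurable_translation lmeasurable_unit_cell)
    from \<kappa>[OF this] show "C v \<in> lmeasurable" "vol (C v) = \<kappa>"
      by (simp_all add: C_def measure_translation measure_unit_cell)
  qed
  have C_iff: "g u \<in> C v \<longleftrightarrow> vfloor u = vfloor v" for u v
  proof -
    have "g u \<in> C v \<longleftrightarrow> u - vfloor v \<in> unit_cell"
      unfolding C_def inj_image_mem_iff[OF g(2)]
      by (auto simp: image_iff intro!: bexI[of _ "u - vfloor v"])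
    then show ?thesis by (simp add: vfloor_eq_iff)
  qed
  have E_eq: "v = p + vfloor v" if "v \<in> E T" for v
    using that by (auto simp: E_def vfrac_eq)
  have dj: "disjoint_family_on C (E T)"
  proof (unfold disjoint_family_on_def, intro ballI impI)
    fix a b assume ab: "a \<in> E T" "b \<in> E T" "a \<noteq> b"
    show "C a \<inter> C b = {}"
    proof (rule ccontr)
      assume "C a \<inter> C b \<noteq> {}"
      then obtain x where "x \<in> C a" "x \<in> C b" by auto
      moreover obtain u where "x = g u" using bij by (metis bij_pointE)
      ultimately have "vfloor a = vfloor b" using C_iff by metis
      then show False using ab E_eq by metis
    qed
  qed
  have "vol (\<Union>v\<in>E T. C v) = (\<Sum>v\<in>E T. vol (C v))"
    using fmeasurableD[OF Cm(1)] fmeasurableD2[OF Cm(1)]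
    by (intro measure_finite_Union[OF fin _ dj]) auto
  then have vol: "vol (\<Union>v\<in>E T. C v) = \<kappa> * card (E T)" by (simp add: Cm)
  have lm: "(\<Union>v\<in>E T. C v) \<in> lmeasurable" by (intro fmeasurable.finite_UN fin Cm)
  have near: "norm (g u - g v) \<le> R" if "vfloor u = vfloor v" for u v
  proof -
    have "g u - g v = g (vfrac u - vfrac v)" using that by (simp add: vfrac_eq gdiff)
    then show ?thesis using R[OF vfrac_in_unit_cell vfrac_in_unit_cell] by simp
  qed
  have "cball 0 (T - R) \<subseteq> (\<Union>v\<in>E T. C v)"
  proof
    fix x :: "real ^ 'n" assume x: "x \<in> cball 0 (T - R)"
    obtain u where u: "x = g u" using bij by (metis bij_pointE)
    \<comment> \<open>The representative of \<open>p\<close> in the lattice cell of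
      \<open>u\<close>.\<close>
    let ?v = "p + vfloor u"
    have fl: "vfloor ?v = vfloor u" using p by (rule vfloor_unit_cell_add)
    have "norm (g ?v) \<le> norm (g u) + norm (g ?v - g u)" by (rule norm_triangle_sub)
    also have "\<dots> \<le> T" using x u near[OF fl] by simp
    finally have "?v \<in> E T" using vfrac_unit_cell_add[OF p] by (simp add: E_def)
    moreover have "x \<in> C ?v" using u fl by (simp add: C_iff)
    ultimately show "x \<in> (\<Union>v\<in>E T. C v)" by blast
  qed
  then have "vol (cball (0 :: real ^ 'n) (T - R)) \<le> vol (\<Union>v\<in>E T. C v)"
    by (intro measure_mono_fmeasurable lm) auto
  with vol show ?lower by simp
  have "(\<Union>v\<in>E T. C v) \<subseteq> cball 0 (T + R)"
  proof safe
    fix x v assume v: "v \<in> E T" and "x \<in> C v"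
    moreover obtain u where u: "x = g u" using bij by (metis bij_pointE)
    ultimately have "norm (g u - g v) \<le> R" by (intro near) (simp add: C_iff)
    moreover have "norm (g u) \<le> norm (g v) + norm (g u - g v)" by (rule norm_triangle_sub)
    ultimately show "x \<in> cball 0 (T + R)" using v u by (simp add: E_def)
  qed
  then have "vol (\<Union>v\<in>E T. C v) \<le> vol (cball (0 :: real ^ 'n) (T + R))"
    by (intro measure_mono_fmeasurable fmeasurableD lm) auto
  with vol show ?upper by simp
qed

text \<open>Every p in \<open>P\<close> contributes one point per cell of volume \<kappa>. Summing
  the two ball estimates over \<open>P\<close> squeezes the density between multiples of (1 - R/T)^n
  and (1 + R/T)^n, which tend to 1.\<close>

lemma ball_density_periodic:
  fixes g :: "real ^ 'n \<Rightarrow> real ^ 'n"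
  assumes g: "linear g" "inj g" and \<kappa>: "0 < \<kappa>" "\<And>S. S \<in> lmeasurable \<Longrightarrow> g ` S \<in> lmeasurable"
    "\<And>S. S \<in> lmeasurable \<Longrightarrow> vol (g ` S) = \<kappa> * vol S"
    and P: "finite P" "P \<subseteq> unit_cell"
  shows "(ball_density (g ` (vfrac -` P)) \<longlongrightarrow> ereal (card P / \<kappa>)) at_top"
    and "discrete (g ` (vfrac -` P))"
proof -
  let ?L = "g ` (vfrac -` P)"
  define E where "E = (\<lambda>T p. vfrac -` {p} \<inter> g -` cball 0 T)"
  define c where "c = (\<lambda>T. real (card (vfrac -` P \<inter> g -` cball 0 T)))"
  have bnd: "bounded (g -` cball 0 T)" for T by (intro bounded_linear_vimage g bounded_cball)
  have fin: "finite (vfrac -` Q \<inter> g -` cball 0 T)" if "finite Q" for T Q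
    using that bnd by (rule finite_vfrac_fibre)
  have Lc: "cball 0 T \<inter> ?L = g ` (vfrac -` P \<inter> g -` cball 0 T)" for T by auto
  have ec: "ecount (cball 0 T \<inter> ?L) = ereal (c T)" for T
    unfolding Lc using fin[OF P(1)] g(2) by (simp add: ecount_def c_def card_image inj_on_subset)
  \<comment> \<open>This ball contains all differences of points of the unit cell. A crude
    \<open>R\<close> is good enough, as only R/T \<rightarrow> 0 matters.\<close>
  have "bounded (g ` cball 0 (2 * CARD('n)))"
    by (intro bounded_linear_image bounded_cball) (use g in \<open>simp add: linear_conv_bounded_linear\<close>)
  then obtain R where R: "\<And>w. w \<in> cball 0 (2 * CARD('n)) \<Longrightarrow> norm (g w) \<le> R"
    unfolding bounded_iff by blast
  have Rc: "norm (g (u - v)) \<le> R" if "u \<in> unit_cell" "v \<in> unit_cell" for u v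
  proof (rule R)
    have "norm w \<le> CARD('n)" if "w \<in> unit_cell" for w :: "real ^ 'n"
    proof -
      have "norm w \<le> (\<Sum>i\<in>UNIV. \<bar>w $ i\<bar>)" by (rule norm_le_l1_cart)
      also have "\<dots> \<le> (\<Sum>i\<in>(UNIV :: 'n set). 1)" using that by (intro sum_mono) (auto simp: unit_cell_def less_imp_le)
      finally show ?thesis by simp
    qed
    from this[OF that(1)] this[OF that(2)] show "u - v \<in> cball 0 (2 * CARD('n))"
      using norm_triangle_ineq4[of u v] by simp
  qed
  have "0 \<le> R" using R[of 0] linear_0[OF g(1)] by simp
  have c_sum: "c T = (\<Sum>p\<in>P. real (card (E T p)))" for T
  proof -
    have "vfrac -` P \<inter> g -` cball 0 T = (\<Union>p\<in>P. E T p)" by (auto simp: E_def)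
    moreover have "card (\<Union>p\<in>P. E T p) = (\<Sum>p\<in>P. card (E T p))"
      using P(1) fin[of "{_}"] by (intro card_UN_disjoint) (auto simp: E_def)
    ultimately show ?thesis by (simp add: c_def)
  qed
  have lo: "card P * vol (cball (0 :: real ^ 'n) (T - R)) \<le> \<kappa> * c T" for T
  proof -
    have "(\<Sum>p\<in>P. vol (cball (0 :: real ^ 'n) (T - R))) \<le> (\<Sum>p\<in>P. \<kappa> * card (E T p))"
      unfolding E_def using P by (intro sum_mono card_lattice_points_ball g \<kappa> Rc) auto
    then show ?thesis by (simp add: c_sum sum_distrib_left)
  qed
  have hi: "\<kappa> * c T \<le> card P * vol (cball (0 :: real ^ 'n) (T + R))" for T
  proof -
    have "(\<Sum>p\<in>P. \<kappa> * card (E T p)) \<le> (\<Sum>p\<in>P. vol (cball (0 :: real ^ 'n) (T + R)))"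
      unfolding E_def using P by (intro sum_mono card_lattice_points_ball g \<kappa> Rc) auto
    then show ?thesis by (simp add: c_sum sum_distrib_left)
  qed
  let ?n = "CARD('n)"
  let ?b = "unit_ball_vol (real ?n)"
  have b: "0 < ?b" by simp
  have vc: "measure lborel (cball (0 :: real ^ 'n) r) = ?b * r ^ ?n" if "0 \<le> r" for r
    using content_cball[OF that, of "0 :: real ^ 'n"] by simp
  have lim: "((\<lambda>T. card P / \<kappa> * (1 + a / T) ^ ?n) \<longlongrightarrow> card P / \<kappa>) at_top" for a :: real
  proof -
    have "((\<lambda>T. a / T) \<longlongrightarrow> 0) at_top"
      by (intro tendsto_divide_0[OF tendsto_const] filterlim_at_top_imp_at_infinity filterlim_ident)
    then have "((\<lambda>T. card P / \<kappa> * (1 + a / T) ^ ?n) \<longlongrightarrow> card P / \<kappa> * (1 + 0) ^ ?n) at_top"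
      by (intro tendsto_intros)
    then show ?thesis by simp
  qed
  \<comment> \<open>R < T keeps the inner radius T - R nonnegative, as \<open>vc\<close>
    requires.\<close>
  have ev: "\<forall>\<^sub>F T in at_top. R < T \<and> 0 < T" by (intro eventually_conj eventually_gt_at_top)
  have "((\<lambda>T. c T / vol (cball (0 :: real ^ 'n) T)) \<longlongrightarrow> card P / \<kappa>) at_top"
  proof (rule tendsto_sandwich[OF _ _ lim[of "- R"] lim[of R]])
    show "\<forall>\<^sub>F T in at_top. card P / \<kappa> * (1 + - R / T) ^ ?n \<le> c T / vol (cball (0 :: real ^ 'n) T)"
      using ev
    proof eventually_elim
      case (elim T)
      have "(1 + - R / T) ^ ?n = (T - R) ^ ?n / T ^ ?n"
        using elim by (simp add: power_divide[symmetric] diff_divide_distrib)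
      then show ?case using elim lo[of T] \<kappa>(1) b by (simp add: vc divide_simps) (simp add: mult_ac)
    qed
    show "\<forall>\<^sub>F T in at_top. c T / vol (cball (0 :: real ^ 'n) T) \<le> card P / \<kappa> * (1 + R / T) ^ ?n"
      using ev
    proof eventually_elim
      case (elim T)
      have "(1 + R / T) ^ ?n = (T + R) ^ ?n / T ^ ?n"
        using elim by (simp add: power_divide[symmetric] add_divide_distrib)
      then show ?case using elim \<open>0 \<le> R\<close> hi[of T] \<kappa>(1) b by (simp add: vc divide_simps) (simp add: mult_ac)
    qed
  qed
  moreover have "\<forall>\<^sub>F T in at_top. ereal (c T / vol (cball (0 :: real ^ 'n) T)) = ball_density ?L T"
    using ev
  proof eventually_elim
    case (elim T)
    moreover have "?b \<noteq> 0" using b by linarith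
    ultimately show ?case by (simp add: ball_density_def ec vc)
  qed
  ultimately show "(ball_density ?L \<longlongrightarrow> ereal (card P / \<kappa>)) at_top"
    by (auto intro: Lim_transform_eventually)
  \<comment> \<open>The ball of radius norm x + 1 about 0 contains the unit ball about x but only
    finitely many points of the set.\<close>
  show "discrete ?L"
    unfolding discrete_altdef
  proof
    fix x assume "x \<in> ?L"
    have "finite (cball 0 (norm x + 1) \<inter> ?L)" unfolding Lc using fin[OF P(1)] by simp
    then have "closed (cball 0 (norm x + 1) \<inter> ?L - {x})" by (intro finite_imp_closed) simp
    then have "open (ball x 1 - (cball 0 (norm x + 1) \<inter> ?L - {x}))" by (intro open_Diff) auto
    moreover have "x \<in> ball x 1 - (cball 0 (norm x + 1) \<inter> ?L - {x})" by simp
    ultimately have "\<forall>\<^sub>F y in at x. y \<in> ball x 1 - (cball 0 (norm x + 1) \<inter> ?L - {x}) \<and> y \<noteq> x"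
      by (rule eventually_at_in_open[simplified])
    then show "\<forall>\<^sub>F y in at x. y \<notin> ?L"
    proof eventually_elim
      case (elim y)
      have "norm y \<le> norm x + norm (y - x)" by (rule norm_triangle_sub)
      then show ?case using elim by (auto simp: dist_norm norm_minus_commute)
    qed
  qed
qed


section \<open>Affine normalisation of the convex body\<close>

lemma continuous_on_abs_det:
  "continuous_on S (\<lambda>A :: real ^ 'n ^ 'n. \<bar>det A\<bar>)"
  unfolding det_def by (intro continuous_intros)

text \<open>Rows that maximise the determinant: by Cramer's rule every coordinate of a point
  of K is a quotient of two such determinants.\<close>

lemma exists_basis_bounding_coordinates:
  fixes K :: "(real ^ 'n) set"
  assumes "compact K" "0 \<in> interior K"
  obtains A :: "real ^ 'n ^ 'n" where "det A \<noteq> 0" "\<And>j. column j A \<in> K"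
    "\<And>v i. A *v v \<in> K \<Longrightarrow> \<bar>v $ i\<bar> \<le> 1"
proof -
  \<comment> \<open>The vectors are stored as rows, since \<open>A $ j\<close> is a row and
    \<open>S\<close> is then a product of copies of \<open>K\<close>. Transposing at the end turns
    them into columns.\<close>
  define S where "S = {A :: real ^ 'n ^ 'n. \<forall>j. A $ j \<in> K}"
  have "closed S" unfolding S_def
    by (intro closed_vector_box allI compact_imp_closed assms)
  moreover have "bounded S"
  proof -
    obtain a where a: "\<And>x. x \<in> K \<Longrightarrow> norm x \<le> a"
      using compact_imp_bounded[OF assms(1)] by (auto simp: bounded_iff)
    have "norm A \<le> (\<Sum>j\<in>(UNIV :: 'n set). a)" if "A \<in> S" for A
    proof -
      have "norm A \<le> (\<Sum>j\<in>UNIV. norm (A $ j))" unfolding norm_vec_def by (rule L2_set_le_sum) simp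
      also have "\<dots> \<le> (\<Sum>j\<in>(UNIV :: 'n set). a)" using that a by (intro sum_mono) (auto simp: S_def)
      finally show ?thesis .
    qed
    then show ?thesis unfolding bounded_iff by blast
  qed
  ultimately have "compact S" by (simp add: compact_eq_bounded_closed)
  obtain e where e: "0 < e" "cball 0 e \<subseteq> K" using assms(2) by (auto simp: mem_interior_cball)
  \<comment> \<open>A multiple of the identity with rows in \<open>K\<close> shows that the maximal
    determinant is not 0.\<close>
  have diag: "mat e \<in> S"
  proof -
    have "mat e $ j \<in> cball (0 :: real ^ 'n) e" for j
    proof -
      have "mat e $ j = e *\<^sub>R (axis j 1 :: real ^ 'n)" by (simp add: mat_def axis_def vec_eq_iff)
      then show ?thesis using e(1) by simp
    qed
    then show ?thesis using e(2) by (auto simp: S_def)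
  qed
  then obtain M where M: "M \<in> S" "\<And>A. A \<in> S \<Longrightarrow> \<bar>det A\<bar> \<le> \<bar>det M\<bar>"
    using continuous_attains_sup[OF \<open>compact S\<close> _ continuous_on_abs_det] by blast
  have "det (mat e :: real ^ 'n ^ 'n) = e ^ CARD('n)"
    by (subst det_diagonal) (auto simp: mat_def)
  then have "0 < \<bar>det (mat e :: real ^ 'n ^ 'n)\<bar>" using e by simp
  with M(2)[OF diag] have det: "det M \<noteq> 0" by linarith
  show ?thesis
  proof (rule that)
    show "det (transpose M) \<noteq> 0" using det by (simp add: det_transpose)
    show "column j (transpose M) \<in> K" for j using M(1) by (simp add: S_def column_transpose row_def)
    show "\<bar>v $ i\<bar> \<le> 1" if "transpose M *v v \<in> K" for v i
    proof -
      let ?N = "\<chi> j. if j = i then transpose M *v v else M $ j"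
      have "?N \<in> S" using M(1) that by (simp add: S_def)
      then have "\<bar>det ?N\<bar> \<le> \<bar>det M\<bar>" by (rule M(2))
      moreover have "det ?N = v $ i * det M"
      proof -
        have "transpose ?N = (\<chi> j k. if k = i then (transpose M *v v) $ j else transpose M $ j $ k)"
          by (simp add: transpose_def vec_eq_iff)
        moreover have "det \<dots> = v $ i * det (transpose M)" by (rule cramer_lemma)
        ultimately show ?thesis using det_transpose[of ?N] det_transpose[of M] by simp
      qed
      ultimately show ?thesis using det by (simp add: abs_mult)
    qed
  qed
qed


text \<open>In the coordinates of the maximal simplex the body lies in [-1, 1]^n. Dividing by 3 and
  shifting by 1/(6n) \<le> 1/18 gives the bound 1/3 + 1/18 = 7/18 < 2/5. Conversely |u_i| < 1/(6n)
  puts 3 (u_i + 1/(6n)) between 0 and 1/n, so these n coordinates are positive with sum below 1 and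
  describe a point of the simplex.\<close>

lemma exists_normalising_map:
  fixes K :: "(real ^ 'n) set"
  defines "n \<equiv> real CARD('n)"
  assumes "CARD('n) \<ge> 3" "bounded K" "convex K" "interior K \<noteq> {}"
  obtains g :: "real ^ 'n \<Rightarrow> real ^ 'n" and a where "linear g" "inj g"
    "\<And>u i. g u + a \<in> K \<Longrightarrow> \<bar>u $ i\<bar> \<le> 2 / 5"
    "\<And>u. (\<And>i. \<bar>u $ i\<bar> < 1 / (6 * n)) \<Longrightarrow> g u + a \<in> K"
proof -
  obtain v0 where v0: "v0 \<in> interior K" using assms(5) by auto
  \<comment> \<open>Compactness of the closure lets the determinant attain its maximum; membership
    in \<open>K\<close> itself must then be recovered separately.\<close>
  define K0 where "K0 = (\<lambda>x. x - v0) ` closure K"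
  have K0: "compact K0" "convex K0" "0 \<in> interior K0"
  proof -
    show "compact K0" "convex K0"
      using assms by (auto simp: K0_def intro!: compact_translation_subtract convex_translation_subtract convex_closure)
    show "0 \<in> interior K0"
      unfolding K0_def interior_translation_subtract
      using v0 interior_mono[OF closure_subset[of K]] by (intro image_eqI[of _ _ v0]) auto
  qed
  obtain A :: "real ^ 'n ^ 'n" where A: "det A \<noteq> 0" "\<And>j. column j A \<in> K0"
    "\<And>v i. A *v v \<in> K0 \<Longrightarrow> \<bar>v $ i\<bar> \<le> 1"
    using exists_basis_bounding_coordinates[OF K0(1,3)] by blast
  have n: "3 \<le> n" using assms(2) by (simp add: n_def)
  define c :: "real ^ 'n" where "c = (\<chi> i. 1 / (6 * n))"
  define g where "g = (\<lambda>u. A *v (3 *\<^sub>R u))"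
  define a where "a = g c + v0"
  have g: "linear g" unfolding g_def
    by (rule linearI) (simp_all add: scaleR_add_right matrix_vector_right_distrib matrix_vector_mult_scaleR)
  have "inj ((*v) A)" using A(1) by (intro inj_matrix_vector_mult) (simp add: invertible_det_nz)
  then have gi: "inj g" by (simp add: g_def inj_def matrix_vector_mult_scaleR)
  have ga: "g u + a = g (u + c) + v0" for u by (simp add: a_def linear_add[OF g])
  show ?thesis
  proof (rule that[OF g gi, of a])
    fix u i assume "g u + a \<in> K"
    then have "g (u + c) + v0 \<in> closure K" using closure_subset ga by auto
    then have "A *v (3 *\<^sub>R (u + c)) \<in> K0" unfolding K0_def g_def
      by (intro image_eqI[of _ _ "A *v (3 *\<^sub>R (u + c)) + v0"]) auto
    then have "\<bar>(3 *\<^sub>R (u + c)) $ i\<bar> \<le> 1" by (rule A(3))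
    then have "\<bar>3 * u $ i + 3 * c $ i\<bar> \<le> 1" by (simp add: distrib_left)
    moreover have "0 \<le> c $ i" "c $ i \<le> 1 / 18" using n by (auto simp: c_def field_simps)
    ultimately show "\<bar>u $ i\<bar> \<le> 2 / 5" by linarith
  next
    fix u :: "real ^ 'n" assume u: "\<And>i. \<bar>u $ i\<bar> < 1 / (6 * n)"
    define w where "w = (\<lambda>i. 3 * (u $ i + 1 / (6 * n)))"
    define \<tau> where "\<tau> = (\<Sum>i\<in>UNIV. w i)"
    have w: "0 < w i" "w i < 1 / n" for i
      using u[of i] n by (auto simp: w_def abs_less_iff field_simps)
    have "0 < \<tau>" unfolding \<tau>_def by (intro sum_pos) (auto simp: w)
    have "\<tau> < (\<Sum>i\<in>(UNIV :: 'n set). 1 / n)" unfolding \<tau>_def by (intro sum_strict_mono) (auto simp: w)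
    also have "\<dots> = 1" using n by (simp add: n_def)
    finally have "\<tau> < 1" .
    define y where "y = (\<Sum>i\<in>UNIV. (w i / \<tau>) *\<^sub>R column i A)"
    have "y \<in> K0" unfolding y_def
    proof (intro convex_sum K0)
      show "(\<Sum>i\<in>UNIV. w i / \<tau>) = 1" using \<open>0 < \<tau>\<close> by (simp add: sum_divide_distrib[symmetric] \<tau>_def[symmetric])
    qed (use w \<open>0 < \<tau>\<close> A(2) in \<open>auto simp: less_imp_le\<close>)
    then have "y + v0 \<in> closure K" by (auto simp: K0_def)
    \<comment> \<open>As \<tau> < 1, the point \<tau> y + v0 arises from a point of the closure by
      moving it strictly towards the interior point \<open>v0\<close>; so it lies in the interior of
      \<open>K\<close>, even if \<open>K\<close> is not closed.\<close>
    then have "(y + v0) - (1 - \<tau>) *\<^sub>R ((y + v0) - v0) \<in> interior K"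
      using \<open>0 < \<tau>\<close> \<open>\<tau> < 1\<close> by (intro mem_interior_closure_convex_shrink assms(4) v0) auto
    moreover have "g (u + c) = \<tau> *\<^sub>R y"
      unfolding g_def matrix_mult_sum y_def scaleR_sum_right
      using \<open>0 < \<tau>\<close> by (intro sum.cong) (auto simp: w_def c_def scalar_mult_eq_scaleR)
    then have "g u + a = \<tau> *\<^sub>R y + v0" by (simp only: ga)
    then have "(y + v0) - (1 - \<tau>) *\<^sub>R ((y + v0) - v0) = g u + a"
      by (simp add: algebra_simps)
    ultimately show "g u + a \<in> K" using interior_subset by auto
  qed
qed

section \<open>Transport from the torus back to the given body\<close>

theorem theorem1p7:
  fixes \<epsilon> :: real and K :: "(real ^ 'n) set"
  assumes "0 < \<epsilon>" and "\<epsilon> < 1"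
    and "CARD('n) \<ge> 20"
    and "bounded K" and "convex K" and "interior K \<noteq> {}"
  shows "\<exists>L :: (real ^ 'n) set.
           discrete L \<and> has_asymptotic_density L \<and>
           ereal (vol K) * upper_density L
             \<le> ereal (14 / \<epsilon>\<^sup>2 * (real CARD('n) * ln (real CARD('n))
                       + real CARD('n) * ln (1280 / \<epsilon>) + 2)) \<and>
           eta K L < ereal \<epsilon>"
proof -
  obtain g :: "real ^ 'n \<Rightarrow> real ^ 'n" and a where g: "linear g" "inj g"
    and sub: "\<And>u i. g u + a \<in> K \<Longrightarrow> \<bar>u $ i\<bar> \<le> 2 / 5"
    and sup: "\<And>u. (\<And>i. \<bar>u $ i\<bar> < 1 / (6 * real CARD('n))) \<Longrightarrow> g u + a \<in> K"
    by (rule exists_normalising_map[OF _ assms(4-6)]) (use assms(3) in auto)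
  define K1 where "K1 = {u. g u + a \<in> K}"
  have bij: "bij g" using g linear_injective_imp_surjective[OF g] by (simp add: bij_def)
  have K_eq: "K = (+) a ` g ` K1"
  proof
    show "K \<subseteq> (+) a ` g ` K1"
    proof
      fix x assume "x \<in> K"
      obtain u where "x - a = g u" using bij by (metis bij_pointE)
      then have "x = a + g u" by (simp add: algebra_simps)
      with \<open>x \<in> K\<close> show "x \<in> (+) a ` g ` K1" by (auto simp: K1_def add.commute)
    qed
  qed (auto simp: K1_def add.commute)
  have K1: "convex K1"
  proof -
    have "K1 = g -` ((\<lambda>x. x - a) ` K)"
      by (force simp: K1_def)
    then show ?thesis by (simp add: convex_linear_vimage[OF g(1)] assms(5))
  qed
  have K1_sub: "\<bar>u $ i\<bar> \<le> 2 / 5" if "u \<in> K1" for u i using that sub by (simp add: K1_def)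
  have K1_sup: "u \<in> K1" if "\<And>i. \<bar>u $ i\<bar> < 1 / (6 * real CARD('n))" for u using that sup by (simp add: K1_def)
  have K1m: "K1 \<in> lmeasurable"
    using K1_sub by (intro measurable_convex K1 bounded_if_components_le)
  obtain \<kappa> where \<kappa>: "\<And>S. S \<in> lmeasurable \<Longrightarrow> g ` S \<in> lmeasurable" "\<And>S. S \<in> lmeasurable \<Longrightarrow> vol (g ` S) = \<kappa> * vol S"
    using linear_image_scales_measure[OF g(1)] by blast
  have volK: "vol K = \<kappa> * vol K1"
    unfolding K_eq by (simp add: measure_translation \<kappa>(2)[OF K1m])
  have "0 < vol K"
    using measurable_convex[OF assms(5,4)] negligible_convex_interior[OF assms(5)] assms(6)
    unfolding negligible_iff_measure by (simp add: zero_less_measure_iff)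
  \<comment> \<open>The sign of \<kappa> is read off from 0 < vol K = \<kappa> * vol K1, where vol
    K1 is nonnegative.\<close>
  then have "0 < \<kappa>" "0 < vol K1" unfolding volK by (auto simp: zero_less_mult_iff not_less[symmetric])
  obtain P where P: "P \<subseteq> unit_cell" "finite P" "P \<noteq> {}"
    and le: "card P * vol K1 \<le> 14 / \<epsilon>\<^sup>2 * (real CARD('n) * ln (real CARD('n)) + real CARD('n) * ln (1280 / \<epsilon>) + 2)"
    and dev: "\<And>x. \<bar>card (P \<inter> vfrac ` ((+) x ` K1)) - card P * vol K1\<bar> \<le> 9 / 10 * \<epsilon> * (card P * vol K1)"
    using exists_equidistributed_points[OF assms(1,2) K1 K1_sub K1_sup] by blast
  define L where "L = g ` (vfrac -` P)"
  define \<mu> where "\<mu> = card P * vol K1"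
  have "0 < \<mu>" using P \<open>0 < vol K1\<close> by (simp add: \<mu>_def card_gt_0_iff)
  note dens = ball_density_periodic[OF g \<open>0 < \<kappa>\<close> \<kappa> P(2,1), folded L_def]
  have D: "upper_density L = ereal (card P / \<kappa>)"
    unfolding upper_density_def by (intro lim_imp_Limsup dens) simp
  then have KD: "ereal (vol K) * upper_density L = ereal \<mu>"
    using \<open>0 < \<kappa>\<close> by (simp add: volK \<mu>_def)
  have count: "translate_count L K x = ereal (card (P \<inter> vfrac ` ((+) y ` K1)))"
    if y: "g y = a + x" for x y
  proof -
    have "(\<lambda>z. z + x) ` K = g ` (+) y ` K1"
      unfolding K_eq image_image by (simp add: linear_add[OF g(1)] y add.assoc add.commute add.left_commute)
    then have "L \<inter> (\<lambda>z. z + x) ` K = g ` (vfrac -` P \<inter> (+) y ` K1)"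
      using g(2) by (simp add: L_def image_Int)
    moreover have "finite (vfrac -` P \<inter> (+) y ` K1)"
      using K1_sub by (intro finite_vfrac_fibre P bounded_translation bounded_if_components_le)
    \<comment> \<open>Injectivity of \<open>vfrac\<close> on translates of \<open>K1\<close> turns
      the count in space into a count on the torus.\<close>
    moreover have "card (vfrac -` P \<inter> (+) y ` K1) = card (P \<inter> vfrac ` ((+) y ` K1))"
    proof -
      have "inj_on vfrac ((+) y ` K1)"
        using inj_on_vfrac_scaled[OF K1 K1_sub, of 1 y] by simp
      then have "inj_on vfrac (vfrac -` P \<inter> (+) y ` K1)" by (rule inj_on_subset) auto
      moreover have "vfrac ` (vfrac -` P \<inter> (+) y ` K1) = P \<inter> vfrac ` ((+) y ` K1)" by auto
      ultimately show ?thesis using card_image by metis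
    qed
    ultimately show ?thesis
      using g(2) by (simp add: translate_count_def ecount_def card_image inj_on_subset)
  qed
  \<comment> \<open>A uniform bound 9\<epsilon>/10 is used because strict bounds by \<epsilon> for
    each x would not make the supremum smaller than \<epsilon>.\<close>
  have "eta K L \<le> ereal (9 / 10 * \<epsilon>)"
    unfolding eta_def
  proof (rule SUP_least)
    fix x
    obtain y where y: "g y = a + x" using bij by (metis bij_pointE)
    let ?k = "real (card (P \<inter> vfrac ` ((+) y ` K1)))"
    have "\<bar>?k / \<mu> - 1\<bar> = \<bar>?k - \<mu>\<bar> / \<mu>" using \<open>0 < \<mu>\<close> by (simp add: field_simps abs_divide[symmetric])
    also have "\<dots> \<le> 9 / 10 * \<epsilon>"
      using dev[of y] \<open>0 < \<mu>\<close> by (simp add: \<mu>_def[symmetric] pos_divide_le_eq)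
    finally show "\<bar>translate_count L K x / (ereal (vol K) * upper_density L) - 1\<bar> \<le> ereal (9 / 10 * \<epsilon>)"
      using \<open>0 < \<mu>\<close> by (simp add: count[OF y] KD one_ereal_def)
  qed
  also have "ereal (9 / 10 * \<epsilon>) < ereal \<epsilon>" using assms(1) by simp
  finally show ?thesis
    using dens KD le by (intro exI[of _ L]) (auto simp: has_asymptotic_density_def \<mu>_def)
qed

end
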